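(* Let $p\in(0,1)$. With probability at least $1-p$, the regret of UCBVI-CH with external samples (described below) satisfies \[ \mathrm{Regret}(K)\le\frac{SAH^2}{N+1}+e(H+1)\sqrt{KL_N}+60\sqrt{\frac{2H-1}{N+2H-1}}\,H^{3/2}L_N\sqrt{SAK}+15\,\frac{2H-1}{N+2H-1}\,S^2AH^2L_N^2, \] where $L_N=\ln(5SAK(H+N)/p)$.
   Context: Single-task episodic setting: an MDP $(\mathcal S,\mathcal A,H,P,r)$ with finite state space ($|\mathcal S|=S$), finite action space ($|\mathcal A|=A$), horizon $H$, unknown transition $P$ and known deterministic reward $r:\mathcal S\times\mathcal A\to[0,1]$, played for $K$ episodes with initial states $s_1^k$. $\mathrm{Regret}(K)=\sum_{k=1}^K[V_1^*-V_1^{\pi_k}](s_1^k)$, where $V_1^\pi$ is the expected total $H$-step reward of $\pi$ and $V_1^*$ the optimal one. It is assumed that $SAKH$ is large enough that the logarithmic factor exceeds $1$. UCBVI-CH with external samples (parameter integer $N\ge1$): maintain collections $\mathcal H$ (learner's own transitions) and $\mathcal B$ (external transitions), both initially empty. At the start of each episode $k$, for each $(s,a)$ an oracle draws $N$ i.i.d. samples $s'\sim P(\cdot|s,a)$ and adds $(s,a,s')$ to $\mathcal B$. Then compute from $\mathcal H\cup\mathcal B$ the counts and empirical transitions $\hat P_k$ and, by backward induction, $V_{k,H+1}=0$, $Q_{k,h}(s,a)=\min\{H,r(s,a)+\sum_{s'}\hat P_k(s'|s,a)V_{k,h+1}(s')+b_k(s,a)\}$, $V_{k,h}(s)=\max_aQ_{k,h}(s,a)$,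 with bonus $b_k(s,a)=7HL_N\sqrt{1/(N_k(s,a)+kN)}$, where $N_k(s,a)$ is the number of visits to $(s,a)$ in the learner's own trajectories before episode $k$. In episode $k$ the learner plays $a_h=\arg\max_aQ_{k,h}(s_h,a)$ and adds each transition $(s_h,a_h,s_{h+1})$ to $\mathcal H$. *)

theory Defs
  imports "HOL-Probability.Probability"
begin

type_synonym ('s,'a) policy = "nat \<Rightarrow> 's \<Rightarrow> 'a"
type_synonym ('s,'a) tcounts = "'s \<Rightarrow> 'a \<Rightarrow> 's \<Rightarrow> nat"
type_synonym ('s,'a) vcounts = "'s \<Rightarrow> 'a \<Rightarrow> nat"

(* Value of a deterministic non-stationary policy pol under the true transition P,
  indexed by the number m of remaining steps: with m+1 steps to go the current stage is H - m.
  V^pi_1 = Vpi_togo P r H pol H. *)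
fun Vpi_togo :: "('s::finite \<Rightarrow> 'a \<Rightarrow> 's pmf) \<Rightarrow> ('s \<Rightarrow> 'a \<Rightarrow> real) \<Rightarrow> nat \<Rightarrow> ('s,'a) policy
    \<Rightarrow> nat \<Rightarrow> 's \<Rightarrow> real" where
  "Vpi_togo P r H pol 0 s = 0"
| "Vpi_togo P r H pol (Suc m) s =
     r s (pol (H - m) s) + (\<Sum>s'\<in>UNIV. pmf (P s (pol (H - m) s)) s' * Vpi_togo P r H pol m s')"

fun Vstar_togo :: "('s::finite \<Rightarrow> 'a::finite \<Rightarrow> 's pmf) \<Rightarrow> ('s \<Rightarrow> 'a \<Rightarrow> real) \<Rightarrow> nat \<Rightarrow> 's \<Rightarrow> real" where
  "Vstar_togo P r 0 s = 0"
| "Vstar_togo P r (Suc m) s =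
     Max (range (\<lambda>a. r s a + (\<Sum>s'\<in>UNIV. pmf (P s a) s' * Vstar_togo P r m s')))"

definition LN :: "'s::finite itself \<Rightarrow> 'a::finite itself \<Rightarrow> nat \<Rightarrow> nat \<Rightarrow> nat \<Rightarrow> real \<Rightarrow> real" where
  "LN _ _ H N K p = ln (5 * real CARD('s) * real CARD('a) * real K * (real H + real N) / p)"

(* Empirical transition from the transition counts of H union B. *)
definition Phat :: "('s::finite,'a) tcounts \<Rightarrow> 's \<Rightarrow> 'a \<Rightarrow> 's \<Rightarrow> real" where
  "Phat c s a s' = real (c s a s') / real (\<Sum>t\<in>UNIV. c s a t)"

definition bonus :: "nat \<Rightarrow> nat \<Rightarrow> real \<Rightarrow> nat \<Rightarrow> ('s,'a) vcounts \<Rightarrow> 's \<Rightarrow> 'a \<Rightarrow> real" where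
  "bonus H N L k v s a = 7 * real H * L * sqrt (1 / (real (v s a) + real k * real N))"

fun Vk_togo :: "('s::finite \<Rightarrow> 'a::finite \<Rightarrow> real) \<Rightarrow> nat \<Rightarrow> nat \<Rightarrow> real \<Rightarrow> nat
    \<Rightarrow> ('s,'a) tcounts \<Rightarrow> ('s,'a) vcounts \<Rightarrow> nat \<Rightarrow> 's \<Rightarrow> real" where
  "Vk_togo r H N L k c v 0 s = 0"
| "Vk_togo r H N L k c v (Suc m) s =
     Max (range (\<lambda>a. min (real H)
        (r s a + (\<Sum>s'\<in>UNIV. Phat c s a s' * Vk_togo r H N L k c v m s') + bonus H N L k v s a)))"

definition Qk_togo :: "('s::finite \<Rightarrow> 'a::finite \<Rightarrow> real) \<Rightarrow> nat \<Rightarrow> nat \<Rightarrow> real \<Rightarrow> nat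
    \<Rightarrow> ('s,'a) tcounts \<Rightarrow> ('s,'a) vcounts \<Rightarrow> nat \<Rightarrow> 's \<Rightarrow> 'a \<Rightarrow> real" where
  "Qk_togo r H N L k c v m s a = min (real H)
     (r s a + (\<Sum>s'\<in>UNIV. Phat c s a s' * Vk_togo r H N L k c v m s') + bonus H N L k v s a)"

definition greedy :: "('a::finite \<Rightarrow> real) \<Rightarrow> 'a" where
  "greedy f = (SOME a. \<forall>b. f b \<le> f a)"

(* Policy played in episode k: at stage h (h-th step, H-h+1 steps to go) play argmax_a Q_{k,h}(s,a). *)
definition ucb_policy :: "('s::finite \<Rightarrow> 'a::finite \<Rightarrow> real) \<Rightarrow> nat \<Rightarrow> nat \<Rightarrow> real \<Rightarrow> nat
    \<Rightarrow> ('s,'a) tcounts \<Rightarrow> ('s,'a) vcounts \<Rightarrow> ('s,'a) policy" where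
  "ucb_policy r H N L k c v = (\<lambda>h s. greedy (Qk_togo r H N L k c v (H - h) s))"

definition ext_samples :: "('s::finite \<Rightarrow> 'a::finite \<Rightarrow> 's pmf) \<Rightarrow> nat \<Rightarrow> ('s,'a) tcounts \<Rightarrow> ('s,'a) tcounts pmf" where
  "ext_samples P N c = map_pmf
     (\<lambda>\<omega>. \<lambda>s a s'. c s a s' + card {i\<in>{..<N}. \<omega> ((s,a),i) = s'})
     (Pi_pmf (UNIV \<times> {..<N}) undefined (\<lambda>((s,a),i). P s a))"

definition incr3 :: "('s,'a) tcounts \<Rightarrow> 's \<Rightarrow> 'a \<Rightarrow> 's \<Rightarrow> ('s,'a) tcounts" where
  "incr3 c s a s' = (\<lambda>x y z. if x = s \<and> y = a \<and> z = s' then c x y z + 1 else c x y z)"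

definition incr2 :: "('s,'a) vcounts \<Rightarrow> 's \<Rightarrow> 'a \<Rightarrow> ('s,'a) vcounts" where
  "incr2 v s a = (\<lambda>x y. if x = s \<and> y = a then v x y + 1 else v x y)"

(* Play an episode with policy pol from state s, m steps to go (current stage H - m + 1),
  recording each own transition in the counts (H) and the own visit counts. *)
fun play :: "('s::finite \<Rightarrow> 'a::finite \<Rightarrow> 's pmf) \<Rightarrow> ('s,'a) policy \<Rightarrow> nat \<Rightarrow> nat \<Rightarrow> 's
    \<Rightarrow> ('s,'a) tcounts \<times> ('s,'a) vcounts \<Rightarrow> (('s,'a) tcounts \<times> ('s,'a) vcounts) pmf" where
  "play P pol H 0 s cv = return_pmf cv"
| "play P pol H (Suc m) s (c, v) =
     bind_pmf (P s (pol (H - m) s))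
       (\<lambda>s'. play P pol H m s' (incr3 c s (pol (H - m) s) s', incr2 v s (pol (H - m) s)))"

(* Joint law of the run of UCBVI-CH with external samples over the first k episodes.
  Output: counts of H union B, own visit counts, list of the policies pi_1..pi_k. *)
fun ucbvi_run :: "('s::finite \<Rightarrow> 'a::finite \<Rightarrow> 's pmf) \<Rightarrow> ('s \<Rightarrow> 'a \<Rightarrow> real) \<Rightarrow> nat \<Rightarrow> nat \<Rightarrow> real
    \<Rightarrow> (nat \<Rightarrow> 's) \<Rightarrow> nat \<Rightarrow> (('s,'a) tcounts \<times> ('s,'a) vcounts \<times> ('s,'a) policy list) pmf" where
  "ucbvi_run P r H N L init 0 = return_pmf (\<lambda>_ _ _. 0, \<lambda>_ _. 0, [])"
| "ucbvi_run P r H N L init (Suc k) =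
     bind_pmf (ucbvi_run P r H N L init k) (\<lambda>(c, v, pols).
     bind_pmf (ext_samples P N c) (\<lambda>c'.
     map_pmf (\<lambda>(c'', v''). (c'', v'', pols @ [ucb_policy r H N L (Suc k) c' v]))
       (play P (ucb_policy r H N L (Suc k) c' v) H H (init (Suc k)) (c', v))))"

definition regret :: "('s::finite \<Rightarrow> 'a::finite \<Rightarrow> 's pmf) \<Rightarrow> ('s \<Rightarrow> 'a \<Rightarrow> real) \<Rightarrow> nat
    \<Rightarrow> (nat \<Rightarrow> 's) \<Rightarrow> ('s,'a) policy list \<Rightarrow> real" where
  "regret P r H init pols =
     (\<Sum>k<length pols. Vstar_togo P r H (init (Suc k)) - Vpi_togo P r H (pols ! k) H (init (Suc k)))"

end

theory Submission
  imports Defs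
begin

text \<open>On the event that all empirical models are accurate, optimism bounds the regret of an episode by
  its gap \<open>V\<^sub>k - V\<^sup>\<pi>\<close>. The gap satisfies a recursion with inflation factor \<open>1 + 1/(3H)\<close>, so it is at
  most 7/5 times the expected confidence width accumulated along the episode. Stopping this accumulation
  as soon as it exceeds \<open>12H/5\<close>, or as soon as a pair with fewer than \<open>H\<close> samples is visited, costs at
  most \<open>7H/5\<close>, as the gap never exceeds \<open>H\<close>. This makes every episode a bounded random variable of range
  \<open>19H/5 < sqrt 2 * e * H\<close>, so that the fluctuations over \<open>K\<close> episodes are of order \<open>H sqrt (K L)\<close>,
  without the additional factor \<open>sqrt H\<close> of a step-by-step argument. The realised widths are summed
  by a potential of the visit counts; since \<open>k\<close> episodes contribute \<open>k N\<close> external samples and at most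
  \<open>k H\<close> visits, the sample count of a pair with \<open>v\<close> visits is at least \<open>v (1 + N/H) - H\<close>, which gives
  the damping factor. All union bounds, including the one over successor states, fit into a
  failure exponent of \<open>2 L\<close>.\<close>

section \<open>Exponential weights of the transition counts\<close>

text \<open>Sum of \<open>\<xi>\<close> over all recorded successors of \<open>(x, y)\<close>, own
  and external alike. If \<open>exp \<xi>\<close> has mean at most 1 under \<open>P x y\<close>, the
  exponential of this sum is a supermartingale along the run, however adaptively the pair is
  sampled.\<close>

definition log_weight :: "('s::finite \<Rightarrow> real) \<Rightarrow> 's \<Rightarrow> 'a \<Rightarrow> ('s,'a) tcounts \<Rightarrow> real" where
  "log_weight \<xi> x y c = (\<Sum>t\<in>UNIV. real (c x y t) * \<xi> t)"

lemma log_weight_incr3: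
  "log_weight \<xi> x y (incr3 c s a s') = log_weight \<xi> x y c + (if s = x \<and> a = y then \<xi> s' else 0)"
proof -
  have "real (incr3 c s a s' x y t) * \<xi> t
      = real (c x y t) * \<xi> t + (if t = s' then if s = x \<and> a = y then \<xi> s' else 0 else 0)" for t
    by (auto simp: incr3_def algebra_simps)
  then show ?thesis
    by (simp add: log_weight_def sum.distrib)
qed

text \<open>A step at \<open>(x, y)\<close> multiplies the exponential by
  \<open>exp (\<xi> s')\<close>, of mean at most 1; every other step leaves it unchanged.\<close>

lemma nn_integral_play_exp_log_weight_le:
  fixes P :: "'s::finite \<Rightarrow> 'a::finite \<Rightarrow> 's pmf"
  assumes "(\<integral>\<^sup>+t. ennreal (exp (\<xi> t)) \<partial>P x y) \<le> 1"
  shows "(\<integral>\<^sup>+z. ennreal (exp (log_weight \<xi> x y (fst z))) \<partial>play P pol H m s (c, v))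
           \<le> ennreal (exp (log_weight \<xi> x y c))"
proof (induction m arbitrary: s c v)
  case (Suc m)
  define a where "a = pol (H - m) s"
  define w where "w = log_weight \<xi> x y c"
  have "(\<integral>\<^sup>+z. ennreal (exp (log_weight \<xi> x y (fst z))) \<partial>play P pol H (Suc m) s (c, v))
      \<le> (\<integral>\<^sup>+s'. ennreal (exp (log_weight \<xi> x y (incr3 c s a s'))) \<partial>P s a)"
    using Suc.IH by (auto simp: a_def intro!: nn_integral_mono)
  also have "\<dots> = (\<integral>\<^sup>+s'. ennreal (exp w) * ennreal (exp (if s = x \<and> a = y then \<xi> s' else 0)) \<partial>P s a)"
    by (simp add: log_weight_incr3 exp_add ennreal_mult w_def)
  also have "\<dots> = ennreal (exp w) * (\<integral>\<^sup>+s'. ennreal (exp (if s = x \<and> a = y then \<xi> s' else 0)) \<partial>P s a)"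
    by (rule nn_integral_cmult) simp
  also have "\<dots> \<le> ennreal (exp w) * 1"
    using assms by (intro mult_left_mono) (cases "s = x \<and> a = y"; auto)+
  finally show ?case by (simp add: w_def)
qed simp

lemma log_weight_add_samples:
  fixes \<omega> :: "('s::finite \<times> 'a) \<times> nat \<Rightarrow> 's"
  shows "log_weight \<xi> x y (\<lambda>s a s'. c s a s' + card {i\<in>{..<N}. \<omega> ((s,a),i) = s'})
           = log_weight \<xi> x y c + (\<Sum>i<N. \<xi> (\<omega> ((x,y),i)))"
proof -
  have "(\<Sum>i<N. \<xi> (\<omega> ((x,y),i))) = (\<Sum>t\<in>UNIV. \<Sum>i\<in>{i\<in>{..<N}. \<omega> ((x,y),i) = t}. \<xi> (\<omega> ((x,y),i)))"
    by (rule sum.group[symmetric]) auto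
  also have "\<dots> = (\<Sum>t\<in>UNIV. real (card {i\<in>{..<N}. \<omega> ((x,y),i) = t}) * \<xi> t)"
    by (intro sum.cong refl) (simp add: sum.If_cases)
  finally show ?thesis
    by (simp add: log_weight_def distrib_right sum.distrib)
qed

text \<open>By independence the exponential of the batch factorises over the sample indices, and
  each factor has mean at most 1.\<close>

lemma nn_integral_ext_samples_exp_log_weight_le:
  fixes P :: "'s::finite \<Rightarrow> 'a::finite \<Rightarrow> 's pmf"
  assumes "(\<integral>\<^sup>+t. ennreal (exp (\<xi> t)) \<partial>P x y) \<le> 1"
  shows "(\<integral>\<^sup>+c'. ennreal (exp (log_weight \<xi> x y c')) \<partial>ext_samples P N c)
           \<le> ennreal (exp (log_weight \<xi> x y c))"
proof -
  define I :: "(('s \<times> 'a) \<times> nat) set" where "I = UNIV \<times> {..<N}"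
  \<comment> \<open>Samples of other pairs get the factor \<open>exp 0 = 1\<close>, so that the
    product runs over the whole index set of \<open>Pi_pmf\<close>.\<close>
  define f :: "('s \<times> 'a) \<times> nat \<Rightarrow> 's \<Rightarrow> ennreal"
    where "f z t = ennreal (exp (if fst z = (x,y) then \<xi> t else 0))" for z t
  define Q :: "('s \<times> 'a) \<times> nat \<Rightarrow> 's pmf" where "Q = (\<lambda>((s,a),i). P s a)"
  have "finite I" by (simp add: I_def)
  have prod: "ennreal (exp (\<Sum>i<N. \<xi> (\<omega> ((x,y),i)))) = (\<Prod>z\<in>I. f z (\<omega> z))" for \<omega>
  proof -
    have "(\<Sum>i<N. \<xi> (\<omega> ((x,y),i))) = (\<Sum>z\<in>{z\<in>I. fst z = (x,y)}. \<xi> (\<omega> z))"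
      by (rule sum.reindex_bij_witness[of _ snd "\<lambda>i. ((x,y),i)"]) (auto simp: I_def)
    also have "\<dots> = (\<Sum>z\<in>I. if fst z = (x,y) then \<xi> (\<omega> z) else 0)"
      using \<open>finite I\<close> by (rule sum.inter_filter)
    finally show ?thesis
      using \<open>finite I\<close> by (simp add: exp_sum f_def prod_ennreal)
  qed
  have "(\<integral>\<^sup>+c'. ennreal (exp (log_weight \<xi> x y c')) \<partial>ext_samples P N c)
      = (\<integral>\<^sup>+\<omega>. ennreal (exp (log_weight \<xi> x y c)) * (\<Prod>z\<in>I. f z (\<omega> z)) \<partial>Pi_pmf I undefined Q)"
    unfolding ext_samples_def nn_integral_map_pmf log_weight_add_samples I_def[symmetric] Q_def[symmetric]
    by (simp add: exp_add ennreal_mult prod)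
  also have "\<dots> = ennreal (exp (log_weight \<xi> x y c)) * (\<Prod>z\<in>I. nn_integral (Q z) (f z))"
    using \<open>finite I\<close> by (simp add: nn_integral_cmult nn_integral_prod_Pi_pmf)
  also have "\<dots> \<le> ennreal (exp (log_weight \<xi> x y c)) * 1"
  proof (rule mult_left_mono)
    have "nn_integral (Q z) (f z) \<le> 1" for z
      using assms by (cases "fst z = (x,y)") (auto simp: f_def[abs_def] Q_def case_prod_unfold)
    with \<open>finite I\<close> show "(\<Prod>z\<in>I. nn_integral (Q z) (f z)) \<le> 1"
    proof (induction I)
      case (insert z I)
      then show ?case using mult_mono[of "nn_integral (Q z) (f z)" 1] by simp
    qed simp
  qed simp
  finally show ?thesis by simp
qed

lemma nn_integral_ucbvi_run_exp_log_weight_le: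
  fixes P :: "'s::finite \<Rightarrow> 'a::finite \<Rightarrow> 's pmf"
  assumes "(\<integral>\<^sup>+t. ennreal (exp (\<xi> t)) \<partial>P x y) \<le> 1"
  shows "(\<integral>\<^sup>+z. ennreal (exp (log_weight \<xi> x y (fst z))) \<partial>ucbvi_run P r H N L init k) \<le> 1"
proof (induction k)
  case (Suc k)
  have "(\<integral>\<^sup>+z. ennreal (exp (log_weight \<xi> x y (fst z))) \<partial>ucbvi_run P r H N L init (Suc k))
      \<le> (\<integral>\<^sup>+z. \<integral>\<^sup>+c'. ennreal (exp (log_weight \<xi> x y c')) \<partial>ext_samples P N (fst z)
            \<partial>ucbvi_run P r H N L init k)"
    using nn_integral_play_exp_log_weight_le[of P x y \<xi>, OF assms]
    by (auto simp: case_prod_unfold intro!: nn_integral_mono)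
  also have "\<dots> \<le> (\<integral>\<^sup>+z. ennreal (exp (log_weight \<xi> x y (fst z))) \<partial>ucbvi_run P r H N L init k)"
    using nn_integral_ext_samples_exp_log_weight_le[of P x y \<xi>, OF assms]
    by (intro nn_integral_mono)
  finally show ?case using Suc.IH by simp
qed (simp add: log_weight_def)

section \<open>Bookkeeping of the counts\<close>

lemma finite_set_pmf_play: "finite (set_pmf (play P pol H m s cv))"
  by (induction m arbitrary: s cv) auto

text \<open>The weight \<open>g\<close> lets one identity serve both the total number of visits,
  with \<open>g = 1\<close>, and the accumulated width of an episode.\<close>

lemma sum_incr2:
  fixes g :: "'s::finite \<Rightarrow> 'a::finite \<Rightarrow> real"
  shows "(\<Sum>x\<in>UNIV. \<Sum>y\<in>UNIV. g x y * real (incr2 v s a x y))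
           = (\<Sum>x\<in>UNIV. \<Sum>y\<in>UNIV. g x y * real (v x y)) + g s a"
proof -
  have "g x y * real (incr2 v s a x y)
      = g x y * real (v x y) + (if x = s then if y = a then g s a else 0 else 0)" for x y
    by (auto simp: incr2_def algebra_simps)
  moreover have "(\<Sum>x\<in>UNIV. \<Sum>y\<in>UNIV. if x = s then if y = a then g s a else 0 else 0) = g s a"
    by (subst sum.swap) simp
  ultimately show ?thesis
    by (simp add: sum.distrib)
qed

lemma member_le_double_sum:
  fixes f :: "'s::finite \<Rightarrow> 'a::finite \<Rightarrow> real"
  assumes "\<And>x y. 0 \<le> f x y"
  shows "f x y \<le> (\<Sum>x\<in>UNIV. \<Sum>y\<in>UNIV. f x y)"
proof -
  have "f x y \<le> (\<Sum>y\<in>UNIV. f x y)"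
    by (rule member_le_sum) (auto simp: assms)
  also have "\<dots> \<le> (\<Sum>x\<in>UNIV. \<Sum>y\<in>UNIV. f x y)"
    by (rule member_le_sum[where f = "\<lambda>x. \<Sum>y\<in>UNIV. f x y"]) (auto simp: assms intro!: sum_nonneg)
  finally show ?thesis .
qed

text \<open>For the third claim, each transition raises both counts of its own pair by one, so their
  difference is invariant; it is written additively to avoid subtraction on
  \<open>nat\<close>.\<close>

lemma play_support:
  fixes P :: "'s::finite \<Rightarrow> 'a::finite \<Rightarrow> 's pmf"
  assumes "z \<in> set_pmf (play P pol H m s (c, v))"
  shows "v \<le> snd z"
    and "(\<Sum>x\<in>UNIV. \<Sum>y\<in>UNIV. real (snd z x y)) = (\<Sum>x\<in>UNIV. \<Sum>y\<in>UNIV. real (v x y)) + real m"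
    and "(\<Sum>t\<in>UNIV. fst z x y t) + v x y = (\<Sum>t\<in>UNIV. c x y t) + snd z x y"
  using assms
proof (induction m arbitrary: s c v)
  case (Suc m)
  {
    case (1 s c v)
    define a where "a = pol (H - m) s"
    from 1
    have "\<exists>s'. z \<in> set_pmf (play P pol H m s' (incr3 c s a s', incr2 v s a))"
      by (auto simp: a_def)
    then obtain s' where "z \<in> set_pmf (play P pol H m s' (incr3 c s a s', incr2 v s a))" ..
    from Suc.IH(1)[OF this] have "incr2 v s a \<le> snd z" .
    moreover have "v \<le> incr2 v s a"
      by (auto simp: incr2_def le_fun_def)
    ultimately show ?case by simp
  next
    case (2 s c v)
    define a where "a = pol (H - m) s"
    from 2
    have "\<exists>s'. z \<in> set_pmf (play P pol H m s' (incr3 c s a s', incr2 v s a))"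
      by (auto simp: a_def)
    then obtain s' where "z \<in> set_pmf (play P pol H m s' (incr3 c s a s', incr2 v s a))" ..
    from Suc.IH(2)[OF this] show ?case
      using sum_incr2[of "\<lambda>_ _. 1" v s a] by simp
  next
    case (3 s c v)
    define a where "a = pol (H - m) s"
    from 3
    have "\<exists>s'. z \<in> set_pmf (play P pol H m s' (incr3 c s a s', incr2 v s a))"
      by (auto simp: a_def)
    then obtain s' where z: "z \<in> set_pmf (play P pol H m s' (incr3 c s a s', incr2 v s a))" ..
    have "incr3 c s a s' x y t
        = c x y t + (if t = s' then if x = s \<and> y = a then 1 else 0 else 0)" for t
      by (auto simp: incr3_def)
    then have "(\<Sum>t\<in>UNIV. incr3 c s a s' x y t) + v x y = (\<Sum>t\<in>UNIV. c x y t) + incr2 v s a x y"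
      by (simp add: sum.distrib incr2_def)
    with Suc.IH(3)[OF z] show ?case by simp
  }
qed auto

lemma ext_samples_support:
  assumes "c' \<in> set_pmf (ext_samples P N c)"
  shows "(\<Sum>t\<in>UNIV. c' x y t) = (\<Sum>t\<in>UNIV. c x y t) + N"
proof -
  obtain \<omega> where c': "c' = (\<lambda>s a s'. c s a s' + card {i\<in>{..<N}. \<omega> ((s,a),i) = s'})"
    using assms by (auto simp: ext_samples_def)
  have "real (\<Sum>t\<in>UNIV. c' x y t) = real ((\<Sum>t\<in>UNIV. c x y t) + N)"
    using log_weight_add_samples[of "\<lambda>_. 1" x y c N \<omega>] by (simp add: c' log_weight_def)
  then show ?thesis by (simp only: of_nat_eq_iff)
qed

section \<open>Optimism and the gap recursion\<close>

lemma greedy_ge: "f b \<le> f (greedy f)"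
  for f :: "'a::finite \<Rightarrow> real"
proof -
  have "Max (range f) \<in> range f"
    by (rule Max_in) auto
  then obtain a where "Max (range f) = f a" by (rule rangeE)
  then have "\<forall>b. f b \<le> f a" by (metis Max_ge finite rangeI finite_imageI)
  then have "\<exists>a. \<forall>b. f b \<le> f a" ..
  then have "\<forall>b. f b \<le> f (greedy f)"
    unfolding greedy_def by (rule someI_ex)
  then show ?thesis ..
qed

lemma Max_range_greedy: "Max (range f) = f (greedy f)"
  for f :: "'a::finite \<Rightarrow> real"
  by (rule Max_eqI) (auto simp: greedy_ge)

lemma pmf_average_le:
  fixes q :: "'s::finite pmf"
  assumes "\<And>t. f t \<le> c"
  shows "(\<Sum>t\<in>UNIV. pmf q t * f t) \<le> c"
proof -
  have "(\<Sum>t\<in>UNIV. pmf q t * f t) \<le> (\<Sum>t\<in>UNIV. pmf q t * c)"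
    using assms by (intro sum_mono mult_left_mono) auto
  also have "\<dots> = c"
    by (simp add: sum_distrib_right[symmetric] sum_pmf_eq_1)
  finally show ?thesis .
qed

lemma Vstar_togo_bounds:
  assumes "\<And>s a. 0 \<le> r s a" "\<And>s a. r s a \<le> 1"
  shows "0 \<le> Vstar_togo P r m s" "Vstar_togo P r m s \<le> real m"
proof (induction m arbitrary: s)
  case (Suc m)
  {
    case 1
    show ?case
      unfolding Vstar_togo.simps Max_range_greedy using assms Suc.IH
      by (intro add_nonneg_nonneg sum_nonneg mult_nonneg_nonneg) auto
  next
    case 2
    have "r s a + (\<Sum>t\<in>UNIV. pmf (P s a) t * Vstar_togo P r m t) \<le> 1 + real m" for a
      using assms Suc.IH by (intro add_mono pmf_average_le) auto
    then show ?case by (simp add: Max_range_greedy)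
  }
qed auto

lemma Vpi_togo_nonneg:
  assumes "\<And>s a. 0 \<le> r s a"
  shows "0 \<le> Vpi_togo P r H pol m s"
  using assms by (induction m arbitrary: s) (auto intro!: add_nonneg_nonneg sum_nonneg mult_nonneg_nonneg)

lemma Vpi_togo_le_Vstar_togo: "Vpi_togo P r H pol m s \<le> Vstar_togo P r m s"
proof (induction m arbitrary: s)
  case (Suc m)
  define Q where "Q a = r s a + (\<Sum>t\<in>UNIV. pmf (P s a) t * Vstar_togo P r m t)" for a
  have "Vpi_togo P r H pol (Suc m) s \<le> Q (pol (H - m) s)"
    using Suc.IH by (auto simp: Q_def intro!: sum_mono mult_left_mono)
  also have "\<dots> \<le> Q (greedy Q)"
    by (rule greedy_ge)
  finally show ?case
    unfolding Vstar_togo.simps Max_range_greedy[symmetric] Q_def by simp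
qed simp

lemma Vk_togo_Suc: "Vk_togo r H N L k c v (Suc m) s = Max (range (Qk_togo r H N L k c v m s))"
  by (simp add: Qk_togo_def[abs_def])

lemma Vk_togo_le: "Vk_togo r H N L k c v m s \<le> real H"
proof (cases m)
  case (Suc m')
  show ?thesis unfolding Suc Vk_togo_Suc Max_range_greedy by (simp add: Qk_togo_def)
qed simp

text \<open>What an episode needs of its planning data, free of probability; \<open>n\<close> is the
  sample count inside the bonus. The first accuracy condition is of Hoeffding type and concerns only
  the fixed functions \<open>Vstar_togo P r m\<close>. The second is of Bernstein type, with the
  variance term linearised into a relative error \<open>1 / (3 * real H)\<close>, small enough to
  compound over \<open>H\<close> steps.\<close>

locale accurate_model =
  fixes P :: "'s::finite \<Rightarrow> 'a::finite \<Rightarrow> 's pmf" and r :: "'s \<Rightarrow> 'a \<Rightarrow> real"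
    and H N :: nat and L :: real and k :: nat
    and c :: "('s,'a) tcounts" and v :: "('s,'a) vcounts" and n :: "'s \<Rightarrow> 'a \<Rightarrow> real"
  assumes r: "0 \<le> r s a" "r s a \<le> 1"
    and H: "1 \<le> H" and L: "1 \<le> L"
    and n: "n s a = real (v s a) + real k * real N"
    and n_pos: "0 < n s a"
    and Vstar_accurate: "m < H \<Longrightarrow>
      \<bar>\<Sum>t\<in>UNIV. (Phat c s a t - pmf (P s a) t) * Vstar_togo P r m t\<bar> \<le> real H * sqrt (L / n s a)"
    and pointwise_accurate:
      "Phat c s a t - pmf (P s a) t \<le> pmf (P s a) t / (3 * real H) + 4 * real H * L / n s a"
begin

text \<open>The 8 is 7 from the bonus plus 1 from the error against the optimal value. The second
  term collects, from each of the \<open>CARD('s)\<close> successors, an error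
  \<open>4 * real H * L / n s a\<close> times a value difference of at most
  \<open>H\<close>.\<close>

definition width :: "'s \<Rightarrow> 'a \<Rightarrow> real" where
  "width s a = 8 * real H * L / sqrt (n s a) + 4 * real H ^ 2 * real CARD('s) * L / n s a"

definition pol :: "('s,'a) policy" where
  "pol = ucb_policy r H N L k c v"

definition gap :: "nat \<Rightarrow> 's \<Rightarrow> real" where
  "gap m s = Vk_togo r H N L k c v m s - Vpi_togo P r H pol m s"

lemma width_nonneg: "0 \<le> width s a"
  using L less_imp_le[OF n_pos[of s a]] by (simp add: width_def)

lemma deviation_le: "real H * sqrt (L / n s a) \<le> real H * L / sqrt (n s a)"
proof -
  have "sqrt L \<le> L"
    using L by (intro real_le_lsqrt) (auto simp: power2_eq_square mult_le_cancel_left1)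
  then have "sqrt L / sqrt (n s a) \<le> L / sqrt (n s a)"
    using n_pos[of s a] by (intro divide_right_mono) auto
  then show ?thesis
    by (simp add: real_sqrt_divide mult_left_mono flip: times_divide_eq_right)
qed

lemma bonus_eq: "bonus H N L k v s a = 7 * (real H * L / sqrt (n s a))"
  by (simp add: bonus_def n real_sqrt_divide)

lemma Phat_nonneg: "0 \<le> Phat c s a t"
  unfolding Phat_def by (intro divide_nonneg_nonneg of_nat_0_le_iff)

text \<open>Optimism: the bonus outweighs the model error against the optimal value, and the
  induction hypothesis replaces that value by the optimistic one. Clipping at \<open>H\<close> is
  harmless because the optimal action value with \<open>m + 1\<close> steps to go is at most
  \<open>m + 1\<close>.\<close>

lemma Vstar_le_Vk: "m \<le> H \<Longrightarrow> Vstar_togo P r m s \<le> Vk_togo r H N L k c v m s"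
proof (induction m arbitrary: s)
  case (Suc m)
  let ?Vs = "Vstar_togo P r m" and ?Vk = "Vk_togo r H N L k c v m"
  define Q where "Q a = r s a + (\<Sum>t\<in>UNIV. pmf (P s a) t * ?Vs t)" for a
  have "Q a \<le> Qk_togo r H N L k c v m s a" for a
  proof -
    have "Q a \<le> 1 + real m"
      unfolding Q_def using r Vstar_togo_bounds[of r P m, OF r]
      by (intro add_mono pmf_average_le) auto
    then have 1: "Q a \<le> real H" using Suc.prems by simp
    have "(\<Sum>t\<in>UNIV. Phat c s a t * ?Vs t) \<le> (\<Sum>t\<in>UNIV. Phat c s a t * ?Vk t)"
      using Suc Phat_nonneg by (intro sum_mono mult_left_mono) auto
    moreover have "(\<Sum>t\<in>UNIV. (Phat c s a t - pmf (P s a) t) * ?Vs t)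
        = (\<Sum>t\<in>UNIV. Phat c s a t * ?Vs t) - (\<Sum>t\<in>UNIV. pmf (P s a) t * ?Vs t)"
      by (simp add: left_diff_distrib sum_subtractf)
    moreover have "0 \<le> real H * L / sqrt (n s a)"
      using L n_pos[of s a] by simp
    ultimately have "Q a \<le> r s a + (\<Sum>t\<in>UNIV. Phat c s a t * ?Vk t) + bonus H N L k v s a"
      using Vstar_accurate[of m s a] deviation_le[of s a] Suc.prems
      unfolding bonus_eq Q_def by linarith
    with 1 show ?thesis by (simp add: Qk_togo_def)
  qed
  from this[of "greedy Q"] greedy_ge[of "Qk_togo r H N L k c v m s" "greedy Q"]
  show ?case
    unfolding Vk_togo_Suc Vstar_togo.simps Q_def[symmetric] Max_range_greedy[of "Qk_togo r H N L k c v m s"]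
    using Max_range_greedy[of Q] by simp
qed simp

lemma gap_le: "gap m s \<le> real H"
  using Vk_togo_le[of r H N L k c v m s] Vpi_togo_nonneg[of r P H pol m s] r by (simp add: gap_def)

text \<open>The model error against the optimistic value splits into its error against the optimal value,
  controlled at rate 1/sqrt n, and its error against the difference of the two, which the
  multiplicative bound turns into a 1/n term plus a slight inflation of the expected next gap.\<close>

lemma gap_Suc_le:
  assumes "m < H"
  shows "gap (Suc m) s \<le> width s (pol (H - m) s)
    + (1 + 1 / (3 * real H)) * (\<Sum>t\<in>UNIV. pmf (P s (pol (H - m) s)) t * gap m t)"
proof -
  define a where "a = pol (H - m) s"
  let ?Vs = "Vstar_togo P r m" and ?Vk = "Vk_togo r H N L k c v m" and ?Vp = "Vpi_togo P r H pol m"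
  let ?P = "pmf (P s a)" and ?Ph = "Phat c s a"
  \<comment> \<open>At stage \<open>H - m\<close> the policy maximises the action value with
    \<open>H - (H - m)\<close> further steps, and these are exactly the \<open>m\<close> steps of
    the recursion.\<close>
  have "H - (H - m) = m" using assms by simp
  then have a: "a = greedy (Qk_togo r H N L k c v m s)"
    by (simp add: a_def pol_def ucb_policy_def)
  have "Vk_togo r H N L k c v (Suc m) s \<le> r s a + (\<Sum>t\<in>UNIV. ?Ph t * ?Vk t) + bonus H N L k v s a"
    unfolding Vk_togo_Suc Max_range_greedy a[symmetric] by (simp add: Qk_togo_def)
  then have "gap (Suc m) s \<le> bonus H N L k v s a + ((\<Sum>t\<in>UNIV. ?Ph t * ?Vk t) - (\<Sum>t\<in>UNIV. ?P t * ?Vp t))"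
    unfolding gap_def Vpi_togo.simps a_def[symmetric] by linarith
  also have "(\<Sum>t\<in>UNIV. ?Ph t * ?Vk t) - (\<Sum>t\<in>UNIV. ?P t * ?Vp t)
      = (\<Sum>t\<in>UNIV. (?Ph t - ?P t) * ?Vs t) + (\<Sum>t\<in>UNIV. (?Ph t - ?P t) * (?Vk t - ?Vs t))
        + (\<Sum>t\<in>UNIV. ?P t * gap m t)"
    unfolding sum.distrib[symmetric] sum_subtractf[symmetric]
    by (intro sum.cong refl) (simp add: gap_def algebra_simps)
  \<comment> \<open>Optimism makes the second factor nonnegative, so the one-sided bound on
    \<open>Phat\<close> may be multiplied by it. That factor is then bounded by the gap in the
    relative error and by \<open>H\<close> in the additive one.\<close>
  also have "(\<Sum>t\<in>UNIV. (?Ph t - ?P t) * (?Vk t - ?Vs t))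
      \<le> (\<Sum>t\<in>UNIV. 1 / (3 * real H) * (?P t * gap m t) + 4 * real H ^ 2 * L / n s a)"
  proof (rule sum_mono)
    fix t
    have 1: "0 \<le> ?Vk t - ?Vs t" using Vstar_le_Vk[of m t] assms by simp
    have 2: "?Vk t - ?Vs t \<le> gap m t"
      using Vpi_togo_le_Vstar_togo[of P r H pol m t] by (simp add: gap_def)
    have 3: "?Vk t - ?Vs t \<le> real H"
      using Vk_togo_le[of r H N L k c v m t] Vstar_togo_bounds(1)[of r P m t] r by auto
    have "(?Ph t - ?P t) * (?Vk t - ?Vs t)
        \<le> (?P t / (3 * real H) + 4 * real H * L / n s a) * (?Vk t - ?Vs t)"
      using pointwise_accurate[of s a t] 1 by (rule mult_right_mono)
    also have "\<dots> = ?P t / (3 * real H) * (?Vk t - ?Vs t) + 4 * real H * L / n s a * (?Vk t - ?Vs t)"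
      by (rule distrib_right)
    also have "\<dots> \<le> ?P t / (3 * real H) * gap m t + 4 * real H * L / n s a * real H"
      using 2 3 L n_pos[of s a] by (intro add_mono mult_left_mono) auto
    finally show "(?Ph t - ?P t) * (?Vk t - ?Vs t)
        \<le> 1 / (3 * real H) * (?P t * gap m t) + 4 * real H ^ 2 * L / n s a"
      by (simp add: power2_eq_square mult_ac)
  qed
  also have "\<dots> = 1 / (3 * real H) * (\<Sum>t\<in>UNIV. ?P t * gap m t)
      + 4 * real H ^ 2 * real CARD('s) * L / n s a"
    by (simp add: sum.distrib sum_distrib_left[symmetric] mult_ac flip: sum_divide_distrib)
  finally have "gap (Suc m) s \<le> bonus H N L k v s a + (\<Sum>t\<in>UNIV. (?Ph t - ?P t) * ?Vs t)
      + 4 * real H ^ 2 * real CARD('s) * L / n s a + (1 + 1 / (3 * real H)) * (\<Sum>t\<in>UNIV. ?P t * gap m t)"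
    by (simp add: algebra_simps)
  moreover have "(\<Sum>t\<in>UNIV. (?Ph t - ?P t) * ?Vs t) \<le> real H * L / sqrt (n s a)"
    using Vstar_accurate[OF assms, of s a] deviation_le[of s a] by linarith
  moreover have "width s a = 8 * (real H * L / sqrt (n s a)) + 4 * real H ^ 2 * real CARD('s) * L / n s a"
    by (simp add: width_def)
  moreover have "x \<le> y + q" if "x \<le> 7 * d + e + w + q" "e \<le> d" "y = 8 * d + w" for x y q d e w :: real
    using that by linarith
  ultimately show ?thesis
    unfolding bonus_eq a_def[symmetric] by blast
qed

end

text \<open>The gap can be unrolled along the trajectory, and the unrolling can be stopped at any time at the
  price of the a priori bound \<open>h\<close> on the gap; stopping once the accumulated width exceeds \<open>T\<close>
  keeps the random variable bounded by \<open>T + G * h\<close>.\<close>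

definition stopped_width :: "(('s::finite,'a::finite) vcounts \<Rightarrow> bool) \<Rightarrow> real \<Rightarrow> real \<Rightarrow> ('s \<Rightarrow> 'a \<Rightarrow> real)
    \<Rightarrow> ('s,'a) vcounts \<Rightarrow> ('s,'a) vcounts \<Rightarrow> real" where
  "stopped_width D T R g v w =
     (let A = (\<Sum>x\<in>UNIV. \<Sum>y\<in>UNIV. g x y * (real (w x y) - real (v x y)))
      in if D w \<or> A > T then R else A)"

text \<open>Both stopping conditions persist as the counts grow, so the final counts tell whether
  the episode was stopped. Unrolling weights the width of each step by a power of
  \<open>\<rho>\<close>, at most \<open>G\<close>; a step that triggers stopping replaces the
  remaining value by its bound \<open>h\<close>, again weighted by at most \<open>G\<close>.\<close>

lemma gap_le_expectation_stopped_width: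
  fixes P :: "'s::finite \<Rightarrow> 'a::finite \<Rightarrow> 's pmf" and g :: "'s \<Rightarrow> 'a \<Rightarrow> real"
  assumes g: "\<And>s a. 0 \<le> g s a" and \<rho>: "1 \<le> \<rho>" "\<rho> ^ H \<le> G" and h: "0 \<le> h"
    and f0: "\<And>s. f 0 s \<le> 0" and f: "\<And>m s. f m s \<le> h"
    and step: "\<And>m s. m < H \<Longrightarrow>
      f (Suc m) s \<le> g s (pol (H - m) s) + \<rho> * (\<Sum>t\<in>UNIV. pmf (P s (pol (H - m) s)) t * f m t)"
    and D: "\<And>w w'. w \<le> w' \<Longrightarrow> D w \<Longrightarrow> D w'"
    and "\<not> D v" "0 \<le> T"
  shows "f H s \<le> measure_pmf.expectation (play P pol H H s (c, v))
     (\<lambda>z. stopped_width D T (T + G * h) (\<lambda>s a. G * g s a) v (snd z))"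
proof -
  define A where "A w = (\<Sum>x\<in>UNIV. \<Sum>y\<in>UNIV. G * g x y * (real (w x y) - real (v x y)))"
    for w :: "('s,'a) vcounts"
  define Y where "Y = stopped_width D T (T + G * h) (\<lambda>s a. G * g s a) v"
  have Y_eq: "Y w = (if D w \<or> A w > T then T + G * h else A w)" for w
    by (simp add: Y_def stopped_width_def A_def Let_def)
  have "1 \<le> \<rho> ^ H" using \<rho>(1) by simp
  then have G: "0 \<le> G" using \<rho>(2) by linarith
  have A_mono: "A w \<le> A w'" if "w \<le> w'" for w w'
    unfolding A_def using that g G by (intro sum_mono mult_left_mono) (auto simp: le_fun_def)
  have A_incr2: "A (incr2 w s a) = A w + G * g s a" for w s a
    using sum_incr2[of "\<lambda>x y. G * g x y" w s a] by (simp add: A_def right_diff_distrib sum_subtractf)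
  have pow: "\<rho> ^ j \<le> G" if "j \<le> H" for j
    using power_increasing[OF that \<rho>(1)] \<rho>(2) by linarith
  have stopped: "measure_pmf.expectation (play P pol H m s (c, w)) (\<lambda>z. Y (snd z)) = T + G * h"
    if "D w \<or> A w > T" for m s c w
  proof -
    have "measure_pmf.expectation (play P pol H m s (c, w)) (\<lambda>z. Y (snd z))
        = measure_pmf.expectation (play P pol H m s (c, w)) (\<lambda>z. T + G * h)"
    proof (intro integral_cong_AE AE_pmfI)
      fix z assume "z \<in> set_pmf (play P pol H m s (c, w))"
      then have "w \<le> snd z" by (rule play_support)
      then show "Y (snd z) = T + G * h"
        using that D[of w "snd z"] A_mono[of w "snd z"] by (auto simp: Y_eq)
    qed auto
    then show ?thesis by simp
  qed
  \<comment> \<open>Invariant for an unstopped prefix with counts \<open>w\<close>: the width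
    collected so far plus the value of the rest, inflated by the \<open>H - m\<close> steps already
    made.\<close>
  have "A w + \<rho> ^ (H - m) * f m s \<le> measure_pmf.expectation (play P pol H m s (c, w)) (\<lambda>z. Y (snd z))"
    if "m \<le> H" "\<not> (D w \<or> A w > T)" for m s c w
    using that
  proof (induction m arbitrary: s c w)
    case 0
    have "\<rho> ^ H * f 0 s \<le> 0" using f0[of s] \<rho>(1) by (simp add: mult_nonneg_nonpos)
    then show ?case using 0 by (simp add: Y_eq)
  next
    case (Suc m)
    define a where "a = pol (H - m) s"
    define w' where "w' = incr2 w s a"
    define E where "E t = measure_pmf.expectation (play P pol H m t (incr3 c s a t, w')) (\<lambda>z. Y (snd z))" for t
    have EE: "measure_pmf.expectation (play P pol H (Suc m) s (c, w)) (\<lambda>z. Y (snd z))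
        = (\<Sum>t\<in>UNIV. pmf (P s a) t * E t)"
      unfolding play.simps a_def[symmetric] E_def w'_def
      by (subst pmf_expectation_bind[where A = UNIV]) (auto simp: finite_set_pmf_play)
    have one: "(\<Sum>t\<in>UNIV. pmf (P s a) t * C) = C" for C
      by (simp add: sum_distrib_right[symmetric] sum_pmf_eq_1)
    show ?case
    proof (cases "D w' \<or> A w' > T")
      case True
      then have "(\<Sum>t\<in>UNIV. pmf (P s a) t * E t) = T + G * h"
        using one[of "T + G * h"] by (simp add: E_def stopped)
      \<comment> \<open>The prefix \<open>w\<close> itself was not stopped, hence
        \<open>A w \<le> T\<close>, and \<open>T + G * h\<close> covers both summands.\<close>
      moreover have "\<rho> ^ (H - Suc m) * f (Suc m) s \<le> G * h"
      proof -
        have "\<rho> ^ (H - Suc m) * f (Suc m) s \<le> \<rho> ^ (H - Suc m) * h"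
          using f \<rho>(1) by (intro mult_left_mono) auto
        also have "\<dots> \<le> G * h" using pow h by (intro mult_right_mono) auto
        finally show ?thesis .
      qed
      ultimately show ?thesis using EE Suc.prems by simp
    next
      case False
      have Hm: "H - m = Suc (H - Suc m)" using Suc.prems by simp
      have "A w + \<rho> ^ (H - Suc m) * f (Suc m) s
          \<le> A w + \<rho> ^ (H - Suc m) * (g s a + \<rho> * (\<Sum>t\<in>UNIV. pmf (P s a) t * f m t))"
        using step[of m s] Suc.prems \<rho>(1) by (intro add_left_mono mult_left_mono) (auto simp: a_def)
      also have "\<dots> = A w + \<rho> ^ (H - Suc m) * g s a + \<rho> ^ (H - m) * (\<Sum>t\<in>UNIV. pmf (P s a) t * f m t)"
        unfolding Hm by (simp add: algebra_simps)
      also have "\<rho> ^ (H - Suc m) * g s a \<le> G * g s a"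
        using pow g by (intro mult_right_mono) auto
      also have "A w + G * g s a + \<rho> ^ (H - m) * (\<Sum>t\<in>UNIV. pmf (P s a) t * f m t)
          = (\<Sum>t\<in>UNIV. pmf (P s a) t * (A w' + \<rho> ^ (H - m) * f m t))"
        using one[of "A w'"]
        by (simp add: distrib_left sum.distrib A_incr2 w'_def sum_distrib_left algebra_simps)
      also have "\<dots> \<le> (\<Sum>t\<in>UNIV. pmf (P s a) t * E t)"
        unfolding E_def using Suc.IH[OF _ False] Suc.prems by (intro sum_mono mult_left_mono) auto
      finally show ?thesis using EE by simp
    qed
  qed
  from this[of H v s c] show ?thesis
    using \<open>\<not> D v\<close> \<open>0 \<le> T\<close> by (simp add: A_def Y_def)
qed

section \<open>Concentration along the run\<close>

lemma Hoeffdings_lemma_pmf: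
  fixes q :: "'x pmf" and f :: "'x \<Rightarrow> real"
  assumes "l > 0" "\<And>x. a \<le> f x" "\<And>x. f x \<le> b"
  shows "(\<integral>\<^sup>+x. ennreal (exp (l * (f x - measure_pmf.expectation q f))) \<partial>q) \<le> ennreal (exp (l\<^sup>2 * (b - a)\<^sup>2 / 8))"
proof -
  interpret interval_bounded_random_variable "measure_pmf q" f a b
    by unfold_locales (use assms in auto)
  from Hoeffdings_lemma_nn_integral[OF \<open>l > 0\<close>] show ?thesis by simp
qed

text \<open>Hoeffding's lemma, normalised into an exponent whose exponential has mean at most 1.
  Negative \<open>l\<close>, which serves the lower tail, is handled by passing to
  \<open>- f\<close> with range \<open>[- B, 0]\<close>.\<close>

lemma nn_integral_Hoeffding_weight_le:
  fixes q :: "'s::finite pmf" and f :: "'s \<Rightarrow> real"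
  assumes l: "l \<noteq> 0" and f: "\<And>x. 0 \<le> f x" "\<And>x. f x \<le> B"
  shows "(\<integral>\<^sup>+t. ennreal (exp (l * (f t - (\<Sum>u\<in>UNIV. pmf q u * f u)) - l\<^sup>2 * B\<^sup>2 / 8)) \<partial>q) \<le> 1"
proof -
  have mean: "(\<Sum>u\<in>UNIV. pmf q u * f u) = measure_pmf.expectation q f"
    by (subst integral_measure_pmf_real[where A = UNIV]) (auto simp: mult.commute)
  have "(\<integral>\<^sup>+t. ennreal (exp (l * (f t - measure_pmf.expectation q f))) \<partial>q) \<le> ennreal (exp (l\<^sup>2 * B\<^sup>2 / 8))"
  proof (cases "l > 0")
    case True
    from Hoeffdings_lemma_pmf[of l 0 f B q, OF this f] show ?thesis by simp
  next
    case False
    then have "(\<integral>\<^sup>+t. ennreal (exp (- l * (- f t - measure_pmf.expectation q (\<lambda>t. - f t)))) \<partial>q)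
        \<le> ennreal (exp ((- l)\<^sup>2 * (0 - (- B))\<^sup>2 / 8))"
      using l f by (intro Hoeffdings_lemma_pmf) auto
    then show ?thesis by (simp add: algebra_simps)
  qed
  then have "(\<integral>\<^sup>+t. ennreal (exp (l * (f t - measure_pmf.expectation q f))) * ennreal (exp (- (l\<^sup>2 * B\<^sup>2 / 8))) \<partial>q)
      \<le> ennreal (exp (l\<^sup>2 * B\<^sup>2 / 8)) * ennreal (exp (- (l\<^sup>2 * B\<^sup>2 / 8)))"
    by (subst nn_integral_multc) (auto intro: mult_right_mono)
  then show ?thesis
    by (simp add: mean ennreal_mult[symmetric] exp_add[symmetric])
qed

text \<open>The Lagrange remainder is \<open>exp t / 6 * l ^ 3\<close>; as
  \<open>exp t \<le> 2\<close> and \<open>l \<le> 1/2\<close>, it is at most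
  \<open>l\<^sup>2 / 6\<close>, and 1/2 + 1/6 = 2/3.\<close>

lemma exp_minus_one_le:
  fixes l :: real
  assumes "0 \<le> l" "l \<le> 1/2"
  shows "exp l - 1 \<le> l + 2 / 3 * l\<^sup>2"
proof -
  obtain t where t: "\<bar>t\<bar> \<le> \<bar>l\<bar>" "exp l = (\<Sum>m<3. l ^ m / fact m) + exp t / fact 3 * l ^ 3"
    using Maclaurin_exp_le[of l 3] by blast
  have "exp t \<le> exp (1/2)" using t assms by simp
  also have "\<dots> \<le> (2::real)"
    using exp_bound[of "1/2::real"] by (simp add: power2_eq_square)
  finally have "exp t / fact 3 * l ^ 3 \<le> 2 / fact 3 * l ^ 3"
    using assms by (intro mult_right_mono divide_right_mono) auto
  also have "2 / fact 3 * l ^ 3 = 1 / 3 * l * l\<^sup>2"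
    by (simp add: fact_numeral power2_eq_square power3_eq_cube)
  also have "\<dots> \<le> 1 / 3 * (1/2) * l\<^sup>2"
    using assms by (intro mult_right_mono mult_left_mono) auto
  finally have "exp t / fact 3 * l ^ 3 \<le> 1 / 3 * (1/2) * l\<^sup>2" .
  moreover have "(\<Sum>m<3. l ^ m / fact m) = 1 + l + l\<^sup>2 / 2"
    by (simp add: numeral_3_eq_3 power2_eq_square)
  ultimately show ?thesis
    using t(2) by simp
qed

text \<open>An indicator of mean \<open>pmf q u\<close> has moment generating function
  \<open>1 + (exp l - 1) * pmf q u\<close>. The compensator is proportional to
  \<open>pmf q u\<close>, which later yields a relative error.\<close>

lemma nn_integral_Bernstein_weight_le:
  fixes q :: "'s::finite pmf"
  assumes l: "0 \<le> l" "l \<le> 1/2"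
  shows "(\<integral>\<^sup>+t. ennreal (exp (l * (of_bool (t = u) - pmf q u) - 2 / 3 * l\<^sup>2 * pmf q u)) \<partial>q) \<le> 1"
proof -
  define \<kappa> where "\<kappa> = exp (- (l * pmf q u + 2 / 3 * l\<^sup>2 * pmf q u))"
  have "exp (l * (of_bool (t = u) - pmf q u) - 2 / 3 * l\<^sup>2 * pmf q u) = \<kappa> * (1 + (exp l - 1) * of_bool (t = u))" for t
    by (simp add: \<kappa>_def exp_add[symmetric] algebra_simps)
  then have "(\<integral>\<^sup>+t. ennreal (exp (l * (of_bool (t = u) - pmf q u) - 2 / 3 * l\<^sup>2 * pmf q u)) \<partial>q)
      = ennreal (measure_pmf.expectation q (\<lambda>t. \<kappa> * (1 + (exp l - 1) * of_bool (t = u))))"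
    using l by (subst nn_integral_eq_integral)
      (auto simp: \<kappa>_def intro!: integrable_measure_pmf_finite mult_nonneg_nonneg)
  also have "measure_pmf.expectation q (\<lambda>t. \<kappa> * (1 + (exp l - 1) * of_bool (t = u)))
      = (\<Sum>t\<in>UNIV. \<kappa> * pmf q t + (if t = u then \<kappa> * (exp l - 1) * pmf q u else 0))"
    by (subst integral_measure_pmf_real[where A = UNIV]) (auto simp: algebra_simps intro!: sum.cong)
  also have "\<dots> = \<kappa> * (1 + (exp l - 1) * pmf q u)"
    by (simp add: sum.distrib sum_distrib_left[symmetric] sum_pmf_eq_1 algebra_simps)
  also have "\<dots> \<le> \<kappa> * exp ((l + 2 / 3 * l\<^sup>2) * pmf q u)"
  proof (rule mult_left_mono)
    have "1 + (exp l - 1) * pmf q u \<le> 1 + (l + 2 / 3 * l\<^sup>2) * pmf q u"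
      using exp_minus_one_le[OF l] by (intro add_left_mono mult_right_mono) auto
    also have "\<dots> \<le> exp ((l + 2 / 3 * l\<^sup>2) * pmf q u)"
      by (rule exp_ge_add_one_self)
    finally show "1 + (exp l - 1) * pmf q u \<le> exp ((l + 2 / 3 * l\<^sup>2) * pmf q u)" .
  qed (simp add: \<kappa>_def)
  also have "\<dots> = 1"
    by (simp add: \<kappa>_def exp_add[symmetric] algebra_simps)
  finally show ?thesis by (simp add: ennreal_leI)
qed

text \<open>After the next batch of external samples, the total in the third claim becomes
  \<open>v x y + Suc k * N\<close>, the count in the bonus of the next episode.\<close>

lemma ucbvi_run_support:
  fixes P :: "'s::finite \<Rightarrow> 'a::finite \<Rightarrow> 's pmf"
  assumes "(c, v, pols) \<in> set_pmf (ucbvi_run P r H N L init k)"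
  shows "length pols = k"
    and "(\<Sum>x\<in>UNIV. \<Sum>y\<in>UNIV. real (v x y)) = real k * real H"
    and "(\<Sum>t\<in>UNIV. c x y t) = v x y + k * N"
  using assms
proof (induction k arbitrary: c v pols)
  case (Suc k)
  have *: "\<exists>c0 v0 pols0 c' pol s. (c0, v0, pols0) \<in> set_pmf (ucbvi_run P r H N L init k)
      \<and> c' \<in> set_pmf (ext_samples P N c0)
      \<and> (c, v) \<in> set_pmf (play P pol H H s (c', v0)) \<and> length pols = Suc (length pols0)"
    if "(c, v, pols) \<in> set_pmf (ucbvi_run P r H N L init (Suc k))" for c v pols
    using that by (force simp: case_prod_unfold)
  {
    case 1
    from *[OF this] Suc.IH(1) show ?case by auto
  next
    case (2 c v)
    from *[OF 2] obtain c0 v0 pols0 c' pol s where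
      "(c0, v0, pols0) \<in> set_pmf (ucbvi_run P r H N L init k)"
      "(c, v) \<in> set_pmf (play P pol H H s (c', v0))" by blast
    then show ?case using Suc.IH(2) play_support(2) by (fastforce simp: algebra_simps)
  next
    case (3 c v)
    from *[OF 3] obtain c0 v0 pols0 c' pol s where
      "(c0, v0, pols0) \<in> set_pmf (ucbvi_run P r H N L init k)" "c' \<in> set_pmf (ext_samples P N c0)"
      "(c, v) \<in> set_pmf (play P pol H H s (c', v0))" by blast
    then show ?case using Suc.IH(3)[of c0 v0 pols0] ext_samples_support[of c' P N c0 x y]
        play_support(3)[of "(c, v)" P pol H H s c' v0 x y]
      by simp
  }
qed auto

text \<open>The run of the algorithm does not remember the counts with which earlier episodes were planned.
  The flag records whether all of them satisfied \<open>G\<close>.\<close>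

fun flagged_run :: "(('s,'a) tcounts \<Rightarrow> bool) \<Rightarrow> ('s::finite \<Rightarrow> 'a::finite \<Rightarrow> 's pmf) \<Rightarrow> ('s \<Rightarrow> 'a \<Rightarrow> real)
    \<Rightarrow> nat \<Rightarrow> nat \<Rightarrow> real \<Rightarrow> (nat \<Rightarrow> 's) \<Rightarrow> nat
    \<Rightarrow> ((('s,'a) tcounts \<times> ('s,'a) vcounts \<times> ('s,'a) policy list) \<times> bool) pmf" where
  "flagged_run G P r H N L init 0 = return_pmf ((\<lambda>_ _ _. 0, \<lambda>_ _. 0, []), True)"
| "flagged_run G P r H N L init (Suc k) =
     bind_pmf (flagged_run G P r H N L init k) (\<lambda>((c, v, pols), b).
     bind_pmf (ext_samples P N c) (\<lambda>c'.
     map_pmf (\<lambda>(c'', v''). ((c'', v'', pols @ [ucb_policy r H N L (Suc k) c' v]), b \<and> G c'))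
       (play P (ucb_policy r H N L (Suc k) c' v) H H (init (Suc k)) (c', v))))"

lemma map_fst_flagged_run:
  "map_pmf fst (flagged_run G P r H N L init k) = ucbvi_run P r H N L init k"
proof (induction k)
  case (Suc k)
  show ?case
    unfolding flagged_run.simps ucbvi_run.simps Suc.IH[symmetric] bind_map_pmf map_bind_pmf
    by (simp add: case_prod_unfold map_bind_pmf pmf.map_comp o_def)
qed simp

lemma nn_integral_flagged_run:
  "(\<integral>\<^sup>+z. f (fst z) \<partial>flagged_run G P r H N L init k) = (\<integral>\<^sup>+z. f z \<partial>ucbvi_run P r H N L init k)"
  by (simp add: map_fst_flagged_run[of G, symmetric])

text \<open>Markov's inequality for the exponential weight, read right after the external samples
  arrive, when the episode is planned.\<close>

lemma nn_integral_log_weight_gt_le: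
  fixes P :: "'s::finite \<Rightarrow> 'a::finite \<Rightarrow> 's pmf"
  assumes "(\<integral>\<^sup>+t. ennreal (exp (\<xi> t)) \<partial>P x y) \<le> 1"
  shows "(\<integral>\<^sup>+z. \<integral>\<^sup>+c'. of_bool (log_weight \<xi> x y c' > \<beta>) \<partial>ext_samples P N (fst z)
            \<partial>ucbvi_run P r H N L init k) \<le> ennreal (exp (- \<beta>))"
proof -
  have "(of_bool (log_weight \<xi> x y c' > \<beta>) :: ennreal) \<le> ennreal (exp (log_weight \<xi> x y c')) * ennreal (exp (- \<beta>))" for c'
    by (auto simp: ennreal_mult[symmetric] exp_add[symmetric] simp flip: ennreal_1 intro!: ennreal_leI)
  then have "(\<integral>\<^sup>+z. \<integral>\<^sup>+c'. of_bool (log_weight \<xi> x y c' > \<beta>) \<partial>ext_samples P N (fst z) \<partial>ucbvi_run P r H N L init k)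
      \<le> (\<integral>\<^sup>+z. \<integral>\<^sup>+c'. ennreal (exp (log_weight \<xi> x y c')) * ennreal (exp (- \<beta>))
            \<partial>ext_samples P N (fst z) \<partial>ucbvi_run P r H N L init k)"
    by (intro nn_integral_mono)
  also have "\<dots> = (\<integral>\<^sup>+z. \<integral>\<^sup>+c'. ennreal (exp (log_weight \<xi> x y c')) \<partial>ext_samples P N (fst z)
      \<partial>ucbvi_run P r H N L init k) * ennreal (exp (- \<beta>))"
    by (simp add: nn_integral_multc)
  also have "\<dots> \<le> (\<integral>\<^sup>+z. ennreal (exp (log_weight \<xi> x y (fst z))) \<partial>ucbvi_run P r H N L init k) * ennreal (exp (- \<beta>))"
    using nn_integral_ext_samples_exp_log_weight_le[of P x y \<xi>, OF assms]
    by (intro mult_right_mono nn_integral_mono) auto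
  also have "\<dots> \<le> 1 * ennreal (exp (- \<beta>))"
    using nn_integral_ucbvi_run_exp_log_weight_le[of P x y \<xi>, OF assms] by (intro mult_right_mono) auto
  finally show ?thesis by simp
qed

text \<open>Union bound over the weights in \<open>\<Xi>\<close> and over the planning times of the
  \<open>k\<close> episodes.\<close>

lemma flag_lost_le:
  fixes P :: "'s::finite \<Rightarrow> 'a::finite \<Rightarrow> 's pmf"
  assumes "finite \<Xi>" and \<Xi>: "\<And>x y \<xi>. (x, y, \<xi>) \<in> \<Xi> \<Longrightarrow> (\<integral>\<^sup>+t. ennreal (exp (\<xi> t)) \<partial>P x y) \<le> 1"
    and G: "\<And>c. (\<And>x y \<xi>. (x, y, \<xi>) \<in> \<Xi> \<Longrightarrow> log_weight \<xi> x y c \<le> \<beta>) \<Longrightarrow> G c"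
  shows "(\<integral>\<^sup>+z. of_bool (\<not> snd z) \<partial>flagged_run G P r H N L init k)
           \<le> ennreal (real k * real (card \<Xi>) * exp (- \<beta>))"
proof (induction k)
  case (Suc k)
  have lost: "(of_bool (\<not> (b \<and> G c')) :: ennreal)
      \<le> of_bool (\<not> b) + (\<Sum>(x, y, \<xi>)\<in>\<Xi>. of_bool (log_weight \<xi> x y c' > \<beta>))" for b c'
  proof (cases "b \<and> \<not> G c'")
    case True
    then obtain x y \<xi> where *: "(x, y, \<xi>) \<in> \<Xi>" "\<not> log_weight \<xi> x y c' \<le> \<beta>"
      using G by blast
    have "(1::ennreal) = (\<Sum>(x, y, \<xi>)\<in>{(x, y, \<xi>)}. of_bool (log_weight \<xi> x y c' > \<beta>))"
      using * by simp
    also have "\<dots> \<le> (\<Sum>(x, y, \<xi>)\<in>\<Xi>. of_bool (log_weight \<xi> x y c' > \<beta>))"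
      using * \<open>finite \<Xi>\<close> by (intro sum_mono2) auto
    finally show ?thesis using True by simp
  qed auto
  have "(\<integral>\<^sup>+z. of_bool (\<not> snd z) \<partial>flagged_run G P r H N L init (Suc k))
      = (\<integral>\<^sup>+z. \<integral>\<^sup>+c'. of_bool (\<not> (snd z \<and> G c')) \<partial>ext_samples P N (fst (fst z)) \<partial>flagged_run G P r H N L init k)"
    by (simp add: case_prod_unfold)
  also have "\<dots> \<le> (\<integral>\<^sup>+z. \<integral>\<^sup>+c'. of_bool (\<not> snd z) + (\<Sum>(x, y, \<xi>)\<in>\<Xi>. of_bool (log_weight \<xi> x y c' > \<beta>))
      \<partial>ext_samples P N (fst (fst z)) \<partial>flagged_run G P r H N L init k)"
    using lost by (intro nn_integral_mono)
  also have "\<dots> = (\<integral>\<^sup>+z. of_bool (\<not> snd z) \<partial>flagged_run G P r H N L init k)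
      + (\<integral>\<^sup>+z. \<integral>\<^sup>+c'. (\<Sum>(x, y, \<xi>)\<in>\<Xi>. of_bool (log_weight \<xi> x y c' > \<beta>)) \<partial>ext_samples P N (fst (fst z))
          \<partial>flagged_run G P r H N L init k)"
    by (simp add: nn_integral_add)
  also have "(\<integral>\<^sup>+z. \<integral>\<^sup>+c'. (\<Sum>(x, y, \<xi>)\<in>\<Xi>. of_bool (log_weight \<xi> x y c' > \<beta>)) \<partial>ext_samples P N (fst (fst z))
          \<partial>flagged_run G P r H N L init k)
      = (\<Sum>(x, y, \<xi>)\<in>\<Xi>. \<integral>\<^sup>+z. \<integral>\<^sup>+c'. of_bool (log_weight \<xi> x y c' > \<beta>) \<partial>ext_samples P N (fst z)
          \<partial>ucbvi_run P r H N L init k)"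
    by (subst nn_integral_flagged_run[where f = "\<lambda>z. \<integral>\<^sup>+c'. (\<Sum>(x, y, \<xi>)\<in>\<Xi>. of_bool (log_weight \<xi> x y c' > \<beta>))
          \<partial>ext_samples P N (fst z)"])
      (simp add: case_prod_unfold nn_integral_sum)
  also have "\<dots> \<le> (\<Sum>(x, y, \<xi>)\<in>\<Xi>. ennreal (exp (- \<beta>)))"
  proof (rule sum_mono, clarify)
    fix x y \<xi> assume "(x, y, \<xi>) \<in> \<Xi>"
    from nn_integral_log_weight_gt_le[of P x y \<xi>, OF \<Xi>[OF this]]
    show "(\<integral>\<^sup>+z. \<integral>\<^sup>+c'. of_bool (log_weight \<xi> x y c' > \<beta>) \<partial>ext_samples P N (fst z)
          \<partial>ucbvi_run P r H N L init k) \<le> ennreal (exp (- \<beta>))" .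
  qed
  also have "\<dots> = ennreal (real (card \<Xi>) * exp (- \<beta>))"
    by (simp add: ennreal_mult ennreal_of_nat_eq_real_of_nat)
  also have "(\<integral>\<^sup>+z. of_bool (\<not> snd z) \<partial>flagged_run G P r H N L init k)
      \<le> ennreal (real k * real (card \<Xi>) * exp (- \<beta>))" by (rule Suc.IH)
  finally show ?case
    by (simp add: ennreal_plus[symmetric] algebra_simps add_mono del: ennreal_plus)
qed simp

lemma regret_append:
  "regret P r H init (pols @ [pol]) = regret P r H init pols
     + (Vstar_togo P r H (init (Suc (length pols))) - Vpi_togo P r H pol H (init (Suc (length pols))))"
  by (simp add: regret_def nth_append)

text \<open>An episode whose regret is at most the expectation of some \<open>X\<close> in \<open>[0, R]\<close> contributes
  an exponential supermartingale factor by Hoeffding's lemma; the realised \<open>X\<close> is absorbed by the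
  increase of the potential \<open>\<Psi>\<close>.\<close>

lemma exp_regret_supermartingale:
  fixes P :: "'s::finite \<Rightarrow> 'a::finite \<Rightarrow> 's pmf" and \<Psi> :: "nat \<Rightarrow> ('s,'a) vcounts \<Rightarrow> real"
  assumes l: "l > 0"
    and episode: "\<And>k c v pols c' pol. k < K \<Longrightarrow> (c, v, pols) \<in> set_pmf (ucbvi_run P r H N L init k) \<Longrightarrow>
      c' \<in> set_pmf (ext_samples P N c) \<Longrightarrow> G c' \<Longrightarrow> pol = ucb_policy r H N L (Suc k) c' v \<Longrightarrow>
      \<exists>X. (\<forall>z. 0 \<le> X z \<and> X z \<le> R) \<and>
        Vstar_togo P r H (init (Suc k)) - Vpi_togo P r H pol H (init (Suc k))
          \<le> measure_pmf.expectation (play P pol H H (init (Suc k)) (c', v)) X \<and>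
        (\<forall>z\<in>set_pmf (play P pol H H (init (Suc k)) (c', v)). X z \<le> \<Psi> (Suc k) (snd z) - \<Psi> k v)"
  shows "k \<le> K \<Longrightarrow> (\<integral>\<^sup>+z. ennreal (of_bool (snd z)
      * exp (l * (regret P r H init (snd (snd (fst z))) - \<Psi> k (fst (snd (fst z)))) - real k * (l\<^sup>2 * R\<^sup>2 / 8)))
      \<partial>flagged_run G P r H N L init k) \<le> ennreal (exp (- l * \<Psi> 0 (\<lambda>_ _. 0)))"
proof (induction k)
  case 0
  then show ?case by (simp add: regret_def)
next
  case (Suc k)
  define W where "W k z = ennreal (of_bool (snd z)
      * exp (l * (regret P r H init (snd (snd (fst z))) - \<Psi> k (fst (snd (fst z)))) - real k * (l\<^sup>2 * R\<^sup>2 / 8)))"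
    for k and z :: "(('s,'a) tcounts \<times> ('s,'a) vcounts \<times> ('s,'a) policy list) \<times> bool"
  define pol where "pol c' v = ucb_policy r H N L (Suc k) c' v" for c' v
  define M where "M c' v = play P (pol c' v) H H (init (Suc k)) (c', v)" for c' v
  \<comment> \<open>Given the history and the external samples, the mean of \<open>W\<close> does
    not increase in one episode; once the flag is lost, \<open>W\<close> is zero.\<close>
  have inner: "(\<integral>\<^sup>+y. W (Suc k) ((fst y, snd y, pols @ [pol c' v]), b \<and> G c') \<partial>M c' v) \<le> W k ((c, v, pols), b)"
    if z: "((c, v, pols), b) \<in> set_pmf (flagged_run G P r H N L init k)"
      and c': "c' \<in> set_pmf (ext_samples P N c)" for c v pols b c'
  proof (cases "b \<and> G c'")
    case True
    define Y where "Y = Vstar_togo P r H (init (Suc k)) - Vpi_togo P r H (pol c' v) H (init (Suc k))"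
    have "(c, v, pols) \<in> set_pmf (map_pmf fst (flagged_run G P r H N L init k))"
      using z by force
    then have run: "(c, v, pols) \<in> set_pmf (ucbvi_run P r H N L init k)"
      by (simp only: map_fst_flagged_run)
    then have len: "length pols = k" by (rule ucbvi_run_support)
    from Suc.prems have "k < K" by simp
    from episode[OF this run c' conjunct2[OF True] refl] obtain X
      where X: "\<And>z. 0 \<le> X z" "\<And>z. X z \<le> R"
        and Y: "Y \<le> measure_pmf.expectation (M c' v) X"
        and \<Psi>: "\<And>z. z \<in> set_pmf (M c' v) \<Longrightarrow> X z \<le> \<Psi> (Suc k) (snd z) - \<Psi> k v"
      by (auto simp: Y_def M_def pol_def)
    have "(\<integral>\<^sup>+y. W (Suc k) ((fst y, snd y, pols @ [pol c' v]), b \<and> G c') \<partial>M c' v)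
        \<le> (\<integral>\<^sup>+y. W k ((c, v, pols), b) * ennreal (exp (- (l\<^sup>2 * R\<^sup>2 / 8)))
              * ennreal (exp (l * (- X y - measure_pmf.expectation (M c' v) (\<lambda>y. - X y)))) \<partial>M c' v)"
    proof (intro nn_integral_mono_AE AE_pmfI)
      fix y assume "y \<in> set_pmf (M c' v)"
      \<comment> \<open>The episode adds at most the mean of \<open>X\<close> to the regret and at
        least \<open>X\<close> to the potential, so their difference grows by at most the centred
        variable \<open>- X\<close>.\<close>
      from \<Psi>[OF this] Y have "regret P r H init pols + Y - \<Psi> (Suc k) (snd y)
          \<le> (regret P r H init pols - \<Psi> k v) + (- X y - measure_pmf.expectation (M c' v) (\<lambda>y. - X y))"
        by simp
      then have "l * (regret P r H init pols + Y - \<Psi> (Suc k) (snd y))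
          \<le> l * ((regret P r H init pols - \<Psi> k v) + (- X y - measure_pmf.expectation (M c' v) (\<lambda>y. - X y)))"
        using l by (intro mult_left_mono) auto
      then show "W (Suc k) ((fst y, snd y, pols @ [pol c' v]), b \<and> G c')
          \<le> W k ((c, v, pols), b) * ennreal (exp (- (l\<^sup>2 * R\<^sup>2 / 8)))
              * ennreal (exp (l * (- X y - measure_pmf.expectation (M c' v) (\<lambda>y. - X y))))"
        using True by (auto simp: W_def regret_append len Y_def[symmetric] ennreal_mult[symmetric]
            exp_add[symmetric] algebra_simps add_divide_distrib intro!: ennreal_leI)
    qed
    also have "\<dots> = W k ((c, v, pols), b) * ennreal (exp (- (l\<^sup>2 * R\<^sup>2 / 8)))
        * (\<integral>\<^sup>+y. ennreal (exp (l * (- X y - measure_pmf.expectation (M c' v) (\<lambda>y. - X y)))) \<partial>M c' v)"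
      by (rule nn_integral_cmult) simp
    \<comment> \<open>Hoeffding's lemma for \<open>- X\<close>, with range \<open>[- R, 0]\<close>,
      cancels the compensator.\<close>
    also have "\<dots> \<le> W k ((c, v, pols), b) * ennreal (exp (- (l\<^sup>2 * R\<^sup>2 / 8)))
        * ennreal (exp (l\<^sup>2 * (0 - (- R))\<^sup>2 / 8))"
      using l X by (intro mult_left_mono Hoeffdings_lemma_pmf) auto
    also have "\<dots> = W k ((c, v, pols), b)"
      by (simp add: mult.assoc ennreal_mult[symmetric] exp_add[symmetric])
    finally show ?thesis .
  qed (auto simp: W_def)
  have "(\<integral>\<^sup>+z. W (Suc k) z \<partial>flagged_run G P r H N L init (Suc k))
      = (\<integral>\<^sup>+z. \<integral>\<^sup>+c'. \<integral>\<^sup>+y. W (Suc k) ((fst y, snd y, snd (snd (fst z)) @ [pol c' (fst (snd (fst z)))]), snd z \<and> G c')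
          \<partial>M c' (fst (snd (fst z))) \<partial>ext_samples P N (fst (fst z)) \<partial>flagged_run G P r H N L init k)"
    by (simp add: case_prod_unfold pol_def M_def)
  also have "\<dots> \<le> (\<integral>\<^sup>+z. \<integral>\<^sup>+c'. W k z \<partial>ext_samples P N (fst (fst z)) \<partial>flagged_run G P r H N L init k)"
    by (intro nn_integral_mono_AE AE_pmfI) (use inner in auto)
  also have "\<dots> = (\<integral>\<^sup>+z. W k z \<partial>flagged_run G P r H N L init k)"
    by simp
  finally show ?case using Suc by (simp add: W_def)
qed

section \<open>The potential of the visit counts\<close>

text \<open>Antiderivative of \<open>1 / max 1 u\<close>.\<close>

definition lnlin :: "real \<Rightarrow> real" where
  "lnlin u = (if u \<le> 1 then u - 1 else ln u)"

text \<open>Concavity: the mean slope is at least the slope \<open>1 / max 1 u\<close> at the right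
  end. When the interval contains 1, the claim reduces to
  \<open>0 \<le> (1 - 1 / u) * (1 - u0)\<close>.\<close>

lemma lnlin_diff_ge:
  assumes "u0 \<le> u" "1 \<le> q" "u \<le> q"
  shows "(u - u0) / q \<le> lnlin u - lnlin u0"
proof -
  have "(u - u0) / q \<le> (u - u0) / max 1 u"
    using assms by (intro divide_left_mono) auto
  also have "\<dots> \<le> lnlin u - lnlin u0"
  proof -
    consider "u \<le> 1" | "u > 1" "u0 > 1" | "u > 1" "u0 \<le> 1" by linarith
    then show ?thesis
    proof cases
      case 1
      then show ?thesis using assms(1) by (simp add: lnlin_def)
    next
      case 2
      then have "ln (u0 / u) \<le> u0 / u - 1" by (intro ln_le_minus_one) auto
      then show ?thesis using 2 by (simp add: lnlin_def ln_div diff_divide_distrib)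
    next
      case 3
      then have "ln (1 / u) \<le> 1 / u - 1" by (intro ln_le_minus_one) auto
      then have ln: "1 - 1 / u \<le> ln u" using 3 by (simp add: ln_div)
      have "0 \<le> (1 - 1 / u) * (1 - u0)" using 3 by (intro mult_nonneg_nonneg) auto
      then have "(u - u0) / u \<le> (1 - 1 / u) - (u0 - 1)"
        using 3 by (simp add: algebra_simps diff_divide_distrib)
      with ln 3 show ?thesis by (simp add: lnlin_def)
    qed
  qed
  finally show ?thesis .
qed

lemma lnlin_mono: "u0 \<le> u \<Longrightarrow> lnlin u0 \<le> lnlin u"
  using lnlin_diff_ge[of u0 u "max 1 u"] divide_nonneg_pos[of "u - u0" "max 1 u"] by linarith

text \<open>Removes the shift by 1 at which the potential evaluates \<open>lnlin\<close>. Up to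
  \<open>u = 2\<close> the left side is \<open>u - 2\<close>, hence nonpositive.\<close>

lemma lnlin_le_ln:
  assumes "1 \<le> u"
  shows "lnlin (u - 1) \<le> ln u"
proof (cases "u \<le> 2")
  case True
  have "ln (1 / u) \<le> 1 / u - 1" using assms by (intro ln_le_minus_one) auto
  then have "1 - 1 / u \<le> ln u" using assms by (simp add: ln_div)
  moreover have "0 \<le> (u - 1) * (2 - u) / u" using assms True by (intro divide_nonneg_pos mult_nonneg_nonneg) auto
  then have "0 \<le> 3 - 2 / u - u" using assms by (simp add: algebra_simps diff_divide_distrib add_divide_distrib)
  moreover have "1 / u \<le> 1" using assms by simp
  ultimately show ?thesis using True by (simp add: lnlin_def)
qed (simp add: lnlin_def)

text \<open>The factor \<open>a\<close> is the guaranteed number of samples per own visit: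
  \<open>v + d \<le> k * H\<close> gives \<open>N * (v + d) / H \<le> N * k\<close>, hence
  \<open>(v + d) * a \<le> n + H\<close>. The assumption \<open>H \<le> n\<close> absorbs the
  surplus, and both quotients are bounded by increments of antiderivatives, which telescope over
  episodes.\<close>

lemma visit_sums:
  fixes H N k v d :: nat
  defines "n \<equiv> real v + real k * real N" and "a \<equiv> (real H + real N) / real H"
  assumes H: "1 \<le> H" and d: "d \<le> H" "v + d \<le> k * H" and n: "real H \<le> n"
  shows "real d / sqrt n \<le> 2 * sqrt (2 / a) * (sqrt (real (v + d)) - sqrt (real v))"
    and "real d / n \<le> 1 / a * (lnlin (real (v + d) * a / real H - 1) - lnlin (real v * a / real H - 1))"
proof -
  have a: "1 \<le> a" using H by (simp add: a_def)
  have "real (v + d) \<le> real k * real H" using d(2) by (metis of_nat_le_iff of_nat_mult)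
  then have "real N * (real (v + d) / real H) \<le> real N * real k"
    using H by (intro mult_left_mono) (auto simp: field_simps)
  moreover have "real (v + d) * a = real (v + d) + real N * (real (v + d) / real H)"
    using H by (simp add: a_def field_simps)
  ultimately have va: "real (v + d) * a \<le> n + real H"
    using d(1) by (simp add: n_def algebra_simps)
  have n0: "0 < n" using n H by simp
  show "real d / sqrt n \<le> 2 * sqrt (2 / a) * (sqrt (real (v + d)) - sqrt (real v))"
  proof (cases "d = 0")
    case False
    then have s: "0 < real (v + d)" by simp
    have "real (v + d) * a \<le> 2 * n" using va n by simp
    then have "2 / (2 * n) \<le> 2 / (real (v + d) * a)"
      using a n0 s by (intro divide_left_mono) auto
    then have "1 / n \<le> 2 / a / real (v + d)"
      by (simp add: mult.commute)
    then have "1 / sqrt n \<le> sqrt (2 / a) / sqrt (real (v + d))"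
      by (metis real_sqrt_divide real_sqrt_le_iff real_sqrt_one)
    moreover have "real d / (2 * sqrt (real (v + d))) \<le> sqrt (real (v + d)) - sqrt (real v)"
    proof -
      have "real d = (sqrt (real (v + d)) - sqrt (real v)) * (sqrt (real (v + d)) + sqrt (real v))"
        by (simp add: algebra_simps)
      also have "\<dots> \<le> (sqrt (real (v + d)) - sqrt (real v)) * (2 * sqrt (real (v + d)))"
        by (intro mult_left_mono) auto
      finally show ?thesis using s by (simp add: field_simps)
    qed
    ultimately have "1 / sqrt n * real d \<le> sqrt (2 / a) / sqrt (real (v + d)) * real d"
      and *: "2 * sqrt (2 / a) * (real d / (2 * sqrt (real (v + d))))
        \<le> 2 * sqrt (2 / a) * (sqrt (real (v + d)) - sqrt (real v))"
      using a by (intro mult_right_mono mult_left_mono; simp)+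
    then have "real d / sqrt n \<le> 2 * sqrt (2 / a) * (real d / (2 * sqrt (real (v + d))))"
      by (simp add: mult_ac)
    also note *
    finally show ?thesis .
  qed simp
  \<comment> \<open>Prepares \<open>lnlin_diff_ge\<close> with \<open>q = n / H\<close>, which is at
    least 1; the shift by 1 accounts for the surplus \<open>H\<close>.\<close>
  have "real (v + d) * a / real H - 1 \<le> n / real H"
    using divide_right_mono[OF va, of "real H"] H by (simp add: add_divide_distrib)
  then have "(real (v + d) * a / real H - 1 - (real v * a / real H - 1)) / (n / real H)
      \<le> lnlin (real (v + d) * a / real H - 1) - lnlin (real v * a / real H - 1)"
    using n H a by (intro lnlin_diff_ge diff_right_mono divide_right_mono mult_right_mono) auto
  then have "real d * a / n \<le> lnlin (real (v + d) * a / real H - 1) - lnlin (real v * a / real H - 1)"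
    using H by (simp add: field_simps)
  then have "1 / a * (real d * a / n) \<le> 1 / a * (lnlin (real (v + d) * a / real H - 1) - lnlin (real v * a / real H - 1))"
    using a by (intro mult_left_mono) auto
  then show "real d / n \<le> 1 / a * (lnlin (real (v + d) * a / real H - 1) - lnlin (real v * a / real H - 1))"
    using a by simp
qed

text \<open>Antiderivatives of the two width terms, plus a charge for episodes that visit the pair
  while it has few samples. The factor \<open>133 / 60\<close> is \<open>7 / 5\<close>, the
  compounded inflation, times \<open>19 / 12\<close>, the ratio of the stopped value
  \<open>19 / 5 * H\<close> to the threshold \<open>12 / 5 * H\<close>.\<close>

definition pair_potential :: "nat \<Rightarrow> nat \<Rightarrow> real \<Rightarrow> real \<Rightarrow> nat \<Rightarrow> nat \<Rightarrow> real" where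
  "pair_potential H N L S k v = (let a = (real H + real N) / real H in
     133 / 60 * (8 * real H * L * (2 * sqrt (2 / a) * sqrt (real v))
       + 4 * real H ^ 2 * S * L * (1 / a * lnlin (real v * a / real H - 1)))
     + 19 / 5 * real H * (min (real H) (real k * real N + real v) / (real N + 1)))"

definition potential :: "nat \<Rightarrow> nat \<Rightarrow> real \<Rightarrow> nat \<Rightarrow> ('s::finite,'a::finite) vcounts \<Rightarrow> real" where
  "potential H N L k v = (\<Sum>x\<in>UNIV. \<Sum>y\<in>UNIV. pair_potential H N L (real CARD('s)) k (v x y))"

text \<open>A pair with count below \<open>H\<close> can be visited in at most \<open>H / (N + 1)\<close> episodes, since every
  such episode adds at least \<open>N + 1\<close> to the count.\<close>

lemma pair_potential_increase:
  fixes H N k v d :: nat and L S :: real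
  defines "n \<equiv> real v + real (Suc k) * real N"
  assumes H: "1 \<le> H" and d: "d \<le> H" "v + d \<le> Suc k * H" and L: "0 \<le> L" "0 \<le> S"
  shows "(if n < real H then if 0 < d then 19 / 5 * real H else 0
           else 133 / 60 * (8 * real H * L / sqrt n + 4 * real H ^ 2 * S * L / n) * real d)
         \<le> pair_potential H N L S (Suc k) (v + d) - pair_potential H N L S k v"
proof -
  define a where "a = (real H + real N) / real H"
  have a: "1 \<le> a" using H by (simp add: a_def)
  define s where "s w = 2 * sqrt (2 / a) * sqrt (real w)" for w :: nat
  define l where "l w = 1 / a * lnlin (real w * a / real H - 1)" for w :: nat
  define f where "f k w = min (real H) (real k * real N + real w)" for k w :: nat
  have pp: "pair_potential H N L S k w = 133 / 60 * (8 * real H * L * s w + 4 * real H ^ 2 * S * L * l w)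
      + 19 / 5 * real H * (f k w / (real N + 1))" for k w
    by (simp add: pair_potential_def Let_def a_def[symmetric] s_def l_def f_def)
  have s_mono: "s v \<le> s (v + d)"
    unfolding s_def using a by (intro mult_left_mono) auto
  have l_mono: "l v \<le> l (v + d)"
    unfolding l_def using a H by (intro mult_left_mono lnlin_mono diff_right_mono divide_right_mono mult_right_mono) auto
  have f_mono: "f k v \<le> f (Suc k) (v + d)"
    unfolding f_def by (intro min.mono) (auto simp: algebra_simps)
  have diff: "pair_potential H N L S (Suc k) (v + d) - pair_potential H N L S k v
      = 133 / 60 * (8 * real H * L * (s (v + d) - s v) + 4 * real H ^ 2 * S * L * (l (v + d) - l v))
      + 19 / 5 * real H * ((f (Suc k) (v + d) - f k v) / (real N + 1))"
    unfolding pp by (simp add: algebra_simps diff_divide_distrib)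
  show ?thesis
  proof (cases "n < real H")
    case True
    have "0 \<le> 133 / 60 * (8 * real H * L * (s (v + d) - s v) + 4 * real H ^ 2 * S * L * (l (v + d) - l v))"
      using s_mono l_mono L by simp
    moreover have "of_bool (0 < d) \<le> (f (Suc k) (v + d) - f k v) / (real N + 1)"
    proof (cases "d = 0")
      case False
      \<comment> \<open>In the naturals the strict bound leaves room for one more visit, so the cap
        \<open>H\<close> does not cut off the increase by \<open>N + 1\<close>.\<close>
      have "real (v + Suc k * N) < real H" using True by (simp add: n_def algebra_simps)
      then have "v + Suc k * N < H" by (simp only: of_nat_less_iff)
      then have "N + 1 + (k * N + v) \<le> H" "N + 1 + (k * N + v) \<le> Suc k * N + (v + d)" "k * N + v \<le> H"
        using False by auto
      then have "real (N + 1 + (k * N + v)) \<le> real H"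
        "real (N + 1 + (k * N + v)) \<le> real (Suc k * N + (v + d))" "real (k * N + v) \<le> real H"
        by (simp_all only: of_nat_le_iff)
      then have "real N + 1 + (real k * real N + real v) \<le> f (Suc k) (v + d)"
        "f k v = real k * real N + real v"
        unfolding f_def min_def by (simp_all add: algebra_simps)
      then have "real N + 1 \<le> f (Suc k) (v + d) - f k v" by simp
      then show ?thesis using False by simp
    qed (use f_mono in simp)
    then have "19 / 5 * real H * of_bool (0 < d) \<le> 19 / 5 * real H * ((f (Suc k) (v + d) - f k v) / (real N + 1))"
      by (intro mult_left_mono) auto
    ultimately have "19 / 5 * real H * of_bool (0 < d) \<le> pair_potential H N L S (Suc k) (v + d) - pair_potential H N L S k v"
      unfolding diff by linarith
    then show ?thesis using True by auto
  next
    case False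
    then have n: "real H \<le> n" by simp
    from visit_sums[where k = "Suc k" and v = v and d = d and H = H and N = N, folded n_def a_def, OF H d n]
    have "real d / sqrt n \<le> s (v + d) - s v" "real d / n \<le> l (v + d) - l v"
      by (simp_all add: s_def l_def right_diff_distrib)
    then have "133 / 60 * (8 * real H * L * (real d / sqrt n) + 4 * real H ^ 2 * S * L * (real d / n))
        \<le> 133 / 60 * (8 * real H * L * (s (v + d) - s v) + 4 * real H ^ 2 * S * L * (l (v + d) - l v))"
      using L by (intro mult_left_mono add_mono) auto
    moreover have "0 \<le> 19 / 5 * real H * ((f (Suc k) (v + d) - f k v) / (real N + 1))"
      using f_mono by simp
    ultimately show ?thesis unfolding diff using False by (simp add: algebra_simps)
  qed
qed

text \<open>The power is at most \<open>exp (1 / 3)\<close>, and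
  \<open>exp 1 < 2.72 < 2.744 = (7 / 5) ^ 3\<close>.\<close>

lemma compound_le: "(1 + 1 / (3 * real H)) ^ H \<le> 7 / 5"
proof (cases "H = 0")
  case False
  have "(1 + 1 / (3 * real H)) ^ H \<le> exp (1 / (3 * real H)) ^ H"
    by (intro power_mono exp_ge_add_one_self) auto
  also have "\<dots> = exp (1 / 3)"
    using False by (simp add: exp_of_nat_mult[symmetric])
  also have "\<dots> \<le> 7 / 5"
  proof (rule power_le_imp_le_base)
    have "exp (1 / 3 :: real) ^ Suc 2 = exp (real (Suc 2) * (1 / 3))"
      by (rule exp_of_nat_mult[symmetric])
    also have "\<dots> = exp 1" by simp
    finally show "exp (1 / 3) ^ Suc 2 \<le> (7 / 5 :: real) ^ Suc 2"
      using e_less_272 by (simp add: eval_nat_numeral)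
  qed simp
  finally show ?thesis .
qed simp

text \<open>\<open>X\<close> is the stopped width with threshold \<open>12 / 5 * H\<close> and
  stopped value \<open>(12 / 5 + 7 / 5) * H\<close>. A visited pair with few samples alone raises
  the potential by this value. Otherwise the potential grows by at least \<open>19 / 12\<close>
  times the accumulated width, which reaches the stopped value exactly at the threshold.\<close>

lemma (in accurate_model) episode_regret:
  assumes k: "k = Suc k'" and v: "\<And>x y. v x y \<le> k' * H"
  shows "\<exists>X. (\<forall>z. 0 \<le> X z \<and> X z \<le> 19 / 5 * real H) \<and>
      Vstar_togo P r H s - Vpi_togo P r H pol H s
        \<le> measure_pmf.expectation (play P pol H H s (c, v)) X \<and>
      (\<forall>z\<in>set_pmf (play P pol H H s (c, v)). X z \<le> potential H N L k (snd z) - potential H N L k' v)"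
proof -
  define D where "D w \<longleftrightarrow> (\<exists>x y. v x y < w x y \<and> n x y < real H)" for w
  define R where "R = 19 / 5 * real H"
  define A where "A w = (\<Sum>x\<in>UNIV. \<Sum>y\<in>UNIV. 7 / 5 * width x y * (real (w x y) - real (v x y)))" for w
  define X where "X w = stopped_width D (12 / 5 * real H) (12 / 5 * real H + 7 / 5 * real H)
      (\<lambda>s a. 7 / 5 * width s a) v w" for w
  have X_eq: "X w = (if D w \<or> A w > 12 / 5 * real H then R else A w)" for w
    by (simp add: X_def stopped_width_def A_def R_def Let_def)
  have "gap H s \<le> measure_pmf.expectation (play P pol H H s (c, v)) (\<lambda>z. X (snd z))"
    unfolding X_def
  proof (rule gap_le_expectation_stopped_width[where \<rho> = "1 + 1 / (3 * real H)" and f = gap])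
    show "D w'" if "w \<le> w'" "D w" for w w'
      using that unfolding D_def le_fun_def by (meson order_less_le_trans)
    show "gap (Suc m) s \<le> width s (pol (H - m) s)
        + (1 + 1 / (3 * real H)) * (\<Sum>t\<in>UNIV. pmf (P s (pol (H - m) s)) t * gap m t)" if "m < H" for m s
      using that by (rule gap_Suc_le)
    show "(1 + 1 / (3 * real H)) ^ H \<le> 7 / 5" by (rule compound_le)
    show "gap 0 s \<le> 0" for s by (simp add: gap_def)
  qed (auto simp: D_def width_nonneg gap_le)
  moreover have "Vstar_togo P r H s - Vpi_togo P r H pol H s \<le> gap H s"
    using Vstar_le_Vk[of H s] by (simp add: gap_def)
  moreover have X_potential: "X (snd z) \<le> potential H N L k (snd z) - potential H N L k' v \<and> 0 \<le> A (snd z)"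
    if z: "z \<in> set_pmf (play P pol H H s (c, v))" for z
  proof -
    define w where "w = snd z"
    note vw = play_support(1,2)[OF z, folded w_def]
    then have le: "v x y \<le> w x y" for x y by (auto simp: le_fun_def)
    have wH: "w x y - v x y \<le> H" for x y
    proof -
      have "real (w x y) - real (v x y) \<le> (\<Sum>x\<in>UNIV. \<Sum>y\<in>UNIV. real (w x y) - real (v x y))"
        by (rule member_le_double_sum) (auto simp: le)
      also have "\<dots> = real H" using vw(2) by (simp add: sum_subtractf)
      finally show ?thesis by linarith
    qed
    define t where "t x y = (if n x y < real H then if v x y < w x y then R else 0
        else 133 / 60 * width x y * (real (w x y) - real (v x y)))" for x y
    have t_nonneg: "0 \<le> t x y" for x y
      using width_nonneg le by (simp add: t_def R_def)
    have A_nonneg: "0 \<le> A w"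
      unfolding A_def using width_nonneg le by (intro sum_nonneg mult_nonneg_nonneg) auto
    have "X w \<le> (\<Sum>x\<in>UNIV. \<Sum>y\<in>UNIV. t x y)"
    proof (cases "D w")
      case True
      then obtain x y where xy: "v x y < w x y" "n x y < real H" by (auto simp: D_def)
      have "R = t x y" using xy by (simp add: t_def)
      also have "\<dots> \<le> (\<Sum>x\<in>UNIV. \<Sum>y\<in>UNIV. t x y)"
        by (rule member_le_double_sum) (rule t_nonneg)
      finally show ?thesis using True by (simp add: X_eq)
    next
      case False
      have "t x y = 19 / 12 * (7 / 5 * width x y * (real (w x y) - real (v x y)))" for x y
      proof -
        have "\<not> v x y < w x y" if "n x y < real H"
          using False that unfolding D_def by blast
        then have "w x y = v x y" if "n x y < real H"
          using that le[of x y] by simp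
        then show ?thesis by (simp add: t_def)
      qed
      then have "(\<Sum>x\<in>UNIV. \<Sum>y\<in>UNIV. t x y) = 19 / 12 * A w"
        by (simp only: A_def sum_distrib_left)
      then show ?thesis using False A_nonneg by (simp add: X_eq R_def)
    qed
    also have "\<dots> \<le> (\<Sum>x\<in>UNIV. \<Sum>y\<in>UNIV. pair_potential H N L (real CARD('s)) (Suc k') (w x y)
        - pair_potential H N L (real CARD('s)) k' (v x y))"
    proof (intro sum_mono)
      fix x y
      have nk: "n x y = real (v x y) + real (Suc k') * real N" by (simp add: n k)
      have "v x y + (w x y - v x y) \<le> Suc k' * H"
        using wH[of x y] v[of x y] by simp
      from pair_potential_increase[OF H wH this, of L "real CARD('s)" N, unfolded nk[symmetric]] L
      have "(if n x y < real H then if 0 < w x y - v x y then 19 / 5 * real H else 0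
           else 133 / 60 * width x y * real (w x y - v x y))
          \<le> pair_potential H N L (real CARD('s)) (Suc k') (v x y + (w x y - v x y))
            - pair_potential H N L (real CARD('s)) k' (v x y)"
        unfolding width_def by simp
      then show "t x y \<le> pair_potential H N L (real CARD('s)) (Suc k') (w x y)
          - pair_potential H N L (real CARD('s)) k' (v x y)"
        using le[of x y] by (simp only: t_def R_def of_nat_diff zero_less_diff le_add_diff_inverse)
    qed
    also have "\<dots> = potential H N L k w - potential H N L k' v"
      by (simp add: potential_def sum_subtractf k)
    finally show ?thesis using A_nonneg by (simp add: w_def)
  qed
  \<comment> \<open>Outside the support the counts may lie below \<open>v\<close> and make
    \<open>X\<close> negative; truncation at 0 gives bounds for every \<open>z\<close> without
    changing the expectation.\<close>
  moreover have "measure_pmf.expectation (play P pol H H s (c, v)) (\<lambda>z. X (snd z))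
      = measure_pmf.expectation (play P pol H H s (c, v)) (\<lambda>z. max 0 (X (snd z)))"
    using X_potential H by (intro integral_cong_AE AE_pmfI) (auto simp: X_eq R_def)
  ultimately have regret: "Vstar_togo P r H s - Vpi_togo P r H pol H s
        \<le> measure_pmf.expectation (play P pol H H s (c, v)) (\<lambda>z. max 0 (X (snd z)))"
    by linarith
  have "max 0 (X (snd z)) \<le> potential H N L k (snd z) - potential H N L k' v"
    if "z \<in> set_pmf (play P pol H H s (c, v))" for z
    using X_potential[OF that] H by (auto simp: X_eq R_def split: if_splits)
  moreover have "max 0 (X w) \<le> 19 / 5 * real H" for w
    by (auto simp: X_eq R_def max_def)
  ultimately show ?thesis
    using regret by (intro exI[of _ "\<lambda>z. max 0 (X (snd z))"]) auto
qed

section \<open>Accuracy of the empirical model\<close>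

text \<open>Translates a bound on a log weight into a bound on the deviation of an empirical mean,
  scaled by the sample count.\<close>

lemma log_weight_affine:
  fixes f :: "'s::finite \<Rightarrow> real"
  assumes "0 < (\<Sum>t\<in>UNIV. c x y t)"
  shows "log_weight (\<lambda>t. l * (f t - (\<Sum>u\<in>UNIV. pmf q u * f u)) - \<kappa>) x y c
    = real (\<Sum>t\<in>UNIV. c x y t) * (l * (\<Sum>t\<in>UNIV. (Phat c x y t - pmf q t) * f t) - \<kappa>)"
proof -
  define n where "n = real (\<Sum>t\<in>UNIV. c x y t)"
  define \<mu> where "\<mu> = (\<Sum>u\<in>UNIV. pmf q u * f u)"
  have n: "n > 0" unfolding n_def using assms by (simp only: of_nat_0_less_iff)
  have "Phat c x y t = real (c x y t) / n" for t by (simp only: Phat_def n_def)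
  then have "n * (\<Sum>t\<in>UNIV. (Phat c x y t - pmf q t) * f t) = (\<Sum>t\<in>UNIV. real (c x y t) * f t) - n * \<mu>"
    unfolding \<mu>_def sum_distrib_left sum_subtractf[symmetric]
    using n by (intro sum.cong refl) (simp add: field_simps)
  moreover have "n * (l * d - \<kappa>) = l * (n * d) - n * \<kappa>" for d
    by (simp add: algebra_simps)
  ultimately have "n * (l * (\<Sum>t\<in>UNIV. (Phat c x y t - pmf q t) * f t) - \<kappa>)
      = l * ((\<Sum>t\<in>UNIV. real (c x y t) * f t) - n * \<mu>) - n * \<kappa>"
    by simp
  moreover have "log_weight (\<lambda>t. l * (f t - \<mu>) - \<kappa>) x y c
      = (\<Sum>t\<in>UNIV. l * (real (c x y t) * f t) - (l * \<mu> + \<kappa>) * real (c x y t))"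
    unfolding log_weight_def by (intro sum.cong refl) (simp add: algebra_simps)
  moreover have "\<dots> = l * (\<Sum>t\<in>UNIV. real (c x y t) * f t) - (l * \<mu> + \<kappa>) * n"
    unfolding n_def of_nat_sum by (simp only: sum_subtractf sum_distrib_left)
  ultimately show ?thesis
    unfolding n_def[symmetric] \<mu>_def[symmetric] by (simp add: algebra_simps)
qed

text \<open>The exponent is the fixed \<open>l = 1 / (2 * real H)\<close>: then
  \<open>2 / 3 * l\<close> is the relative error \<open>1 / (3 * real H)\<close>, and a threshold
  \<open>2 * L\<close> costs \<open>2 * L / (l * n) = 4 * real H * L / n\<close>.\<close>

definition Bernstein_weights ::
  "('s::finite \<Rightarrow> 'a::finite \<Rightarrow> 's pmf) \<Rightarrow> nat \<Rightarrow> ('s \<times> 'a \<times> ('s \<Rightarrow> real)) set" where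
  "Bernstein_weights P H = (\<lambda>(x, y, u). (x, y, \<lambda>t. 1 / (2 * real H) * (of_bool (t = u) - pmf (P x y) u)
      - 2 / 3 * (1 / (2 * real H))\<^sup>2 * pmf (P x y) u)) ` UNIV"

text \<open>The optimal exponent of Hoeffding's inequality depends on the number \<open>n\<close> of samples, which is
  random; hence one weight per possible value.\<close>

definition Hoeffding_weight :: "('s::finite \<Rightarrow> 'a::finite \<Rightarrow> 's pmf) \<Rightarrow> ('s \<Rightarrow> 'a \<Rightarrow> real) \<Rightarrow> nat \<Rightarrow> real
    \<Rightarrow> 's \<Rightarrow> 'a \<Rightarrow> nat \<Rightarrow> nat \<Rightarrow> real \<Rightarrow> 's \<Rightarrow> real" where
  "Hoeffding_weight P r H L x y m n \<sigma> t = (let l = \<sigma> * sqrt (16 * L / (real n * real H ^ 2)) in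
     l * (Vstar_togo P r m t - (\<Sum>u\<in>UNIV. pmf (P x y) u * Vstar_togo P r m u)) - l\<^sup>2 * real H ^ 2 / 8)"

definition Hoeffding_weights :: "('s::finite \<Rightarrow> 'a::finite \<Rightarrow> 's pmf) \<Rightarrow> ('s \<Rightarrow> 'a \<Rightarrow> real) \<Rightarrow> nat \<Rightarrow> real \<Rightarrow> nat
    \<Rightarrow> ('s \<times> 'a \<times> ('s \<Rightarrow> real)) set" where
  "Hoeffding_weights P r H L M = (\<lambda>(x, y, m, n, \<sigma>). (x, y, Hoeffding_weight P r H L x y m n \<sigma>))
    ` (UNIV \<times> UNIV \<times> {..<H} \<times> {1..M} \<times> {-1, 1})"

lemma finite_weights: "finite (Bernstein_weights P H)" "finite (Hoeffding_weights P r H L M)"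
  by (auto simp: Bernstein_weights_def Hoeffding_weights_def)

lemma card_weights:
  fixes P :: "'s::finite \<Rightarrow> 'a::finite \<Rightarrow> 's pmf"
  shows "card (Bernstein_weights P H \<union> Hoeffding_weights P r H L M)
    \<le> CARD('s) * CARD('a) * CARD('s) + CARD('s) * CARD('a) * H * M * 2"
proof -
  have "card (Bernstein_weights P H) \<le> CARD('s \<times> 'a \<times> 's)"
    unfolding Bernstein_weights_def by (rule card_image_le) simp
  moreover have "card (Hoeffding_weights P r H L M)
      \<le> card (UNIV \<times> UNIV \<times> {..<H} \<times> {1..M} \<times> {-1, 1 :: real} :: ('s \<times> 'a \<times> nat \<times> nat \<times> real) set)"
    unfolding Hoeffding_weights_def by (rule card_image_le) simp
  ultimately show ?thesis
    using card_Un_le[of "Bernstein_weights P H" "Hoeffding_weights P r H L M"]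
    by (simp add: card_cartesian_product algebra_simps)
qed

lemma Bernstein_weights_le:
  assumes "(x, y, \<xi>) \<in> Bernstein_weights P H" "1 \<le> H"
  shows "(\<integral>\<^sup>+t. ennreal (exp (\<xi> t)) \<partial>P x y) \<le> 1"
  using assms nn_integral_Bernstein_weight_le[of "1 / (2 * real H)"]
  by (auto simp: Bernstein_weights_def)

lemma Hoeffding_weights_le:
  assumes "(x, y, \<xi>) \<in> Hoeffding_weights P r H L M" "1 \<le> H" "0 < L"
    and r: "\<And>s a. 0 \<le> r s a" "\<And>s a. r s a \<le> 1"
  shows "(\<integral>\<^sup>+t. ennreal (exp (\<xi> t)) \<partial>P x y) \<le> 1"
proof -
  obtain z where z: "z \<in> UNIV \<times> UNIV \<times> {..<H} \<times> {1..M} \<times> {-1, 1}"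
    "(x, y, \<xi>) = (case z of (x, y, m, n, \<sigma>) \<Rightarrow> (x, y, Hoeffding_weight P r H L x y m n \<sigma>))"
    using assms(1) unfolding Hoeffding_weights_def by (rule imageE)
  obtain x' y' m n \<sigma> where z_eq: "z = (x', y', m, n, \<sigma>)" by (cases z)
  from z have m: "m < H" and n: "1 \<le> n" and \<sigma>: "\<sigma> = -1 \<or> \<sigma> = 1"
    and \<xi>: "\<xi> = Hoeffding_weight P r H L x y m n \<sigma>"
    by (simp_all add: z_eq)
  have "Vstar_togo P r m t \<le> real H" for t
    using Vstar_togo_bounds(2)[of r P m t, OF r] m by linarith
  moreover have "\<sigma> * sqrt (16 * L / (real n * real H ^ 2)) \<noteq> 0"
    using \<sigma> n assms by auto
  ultimately show ?thesis
    unfolding \<xi> Hoeffding_weight_def Let_def using Vstar_togo_bounds(1)[of r P m, OF r]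
    by (intro nn_integral_Hoeffding_weight_le) auto
qed

text \<open>Each weight bound is divided by the sample count and the exponent. The actual count lies
  in \<open>{1..M}\<close>, so a Hoeffding weight tuned to it is available.\<close>

lemma accurate_modelI:
  fixes P :: "'s::finite \<Rightarrow> 'a::finite \<Rightarrow> 's pmf"
  assumes weights: "\<And>x y \<xi>. (x, y, \<xi>) \<in> Bernstein_weights P H \<union> Hoeffding_weights P r H L M \<Longrightarrow>
      log_weight \<xi> x y c \<le> 2 * L"
    and r: "\<And>s a. 0 \<le> r s a" "\<And>s a. r s a \<le> 1" and H: "1 \<le> H" and L: "1 \<le> L"
    and count: "\<And>x y. (\<Sum>t\<in>UNIV. c x y t) = v x y + k * N"
    and bound: "\<And>x y. v x y + k * N \<in> {1..M}"
  shows "accurate_model P r H N L k c v (\<lambda>x y. real (v x y) + real k * real N)"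
proof
  fix x y
  define n where "n = v x y + k * N"
  have n: "n \<in> {1..M}" unfolding n_def by (rule bound)
  then have "0 < n" by simp
  have sum: "(\<Sum>t\<in>UNIV. c x y t) = n" by (simp add: count n_def)
  have real_n: "real (v x y) + real k * real N = real n" by (simp add: n_def)
  show "0 < real (v x y) + real k * real N" unfolding real_n using n by simp
  show "\<bar>\<Sum>t\<in>UNIV. (Phat c x y t - pmf (P x y) t) * Vstar_togo P r m t\<bar>
      \<le> real H * sqrt (L / (real (v x y) + real k * real N))" if "m < H" for m
  proof -
    define l where "l = sqrt (16 * L / (real n * real H ^ 2))"
    define d where "d = (\<Sum>t\<in>UNIV. (Phat c x y t - pmf (P x y) t) * Vstar_togo P r m t)"
    have l_eq: "l = 4 * sqrt L / (sqrt (real n) * real H)"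
      by (simp add: l_def real_sqrt_divide real_sqrt_mult)
    have l_pos: "l > 0" using n L H by (simp add: l_def)
    have l_sq: "l\<^sup>2 = 16 * L / (real n * real H ^ 2)" using L by (simp add: l_def)
    have "\<sigma> * d \<le> real H * sqrt (L / real n)" if \<sigma>: "\<sigma> \<in> {-1, 1}" for \<sigma> :: real
    proof -
      have "(x, y, Hoeffding_weight P r H L x y m n \<sigma>) \<in> Hoeffding_weights P r H L M"
        unfolding Hoeffding_weights_def
        by (rule image_eqI[where x = "(x, y, m, n, \<sigma>)"]) (use \<sigma> n \<open>m < H\<close> in auto)
      then have "log_weight (Hoeffding_weight P r H L x y m n \<sigma>) x y c \<le> 2 * L"
        using weights by blast
      moreover have "Hoeffding_weight P r H L x y m n \<sigma> = (\<lambda>t. \<sigma> * l * (Vstar_togo P r m t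
          - (\<Sum>u\<in>UNIV. pmf (P x y) u * Vstar_togo P r m u)) - (\<sigma> * l)\<^sup>2 * real H ^ 2 / 8)"
        by (rule ext) (simp only: Hoeffding_weight_def Let_def l_def)
      ultimately have "real n * (\<sigma> * l * d - (\<sigma> * l)\<^sup>2 * real H ^ 2 / 8) \<le> 2 * L"
        using log_weight_affine[of c x y "\<sigma> * l" "Vstar_togo P r m" "P x y" "(\<sigma> * l)\<^sup>2 * real H ^ 2 / 8"] \<open>0 < n\<close>
        by (simp only: sum d_def simp_thms)
      moreover have "(\<sigma> * l)\<^sup>2 = l\<^sup>2" using \<sigma> by auto
      \<comment> \<open>The optimal exponent makes the compensator equal to the threshold
        \<open>2 * L\<close>, which leaves the deviation
        \<open>4 * L / (n * l) = H * sqrt (L / n)\<close>.\<close>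
      moreover have "real n * (l\<^sup>2 * real H ^ 2 / 8) = 2 * L" using n H by (simp add: l_sq)
      ultimately have "real n * (\<sigma> * l * d) \<le> 4 * L" by (simp only: right_diff_distrib)
      then have "(\<sigma> * d) * (real n * l) \<le> 4 * L" by (simp add: mult_ac)
      then have "\<sigma> * d \<le> 4 * L / (real n * l)" using n l_pos by (simp add: pos_le_divide_eq)
      also have "\<dots> = real H * (L / sqrt L) * (sqrt (real n) / real n)"
        using L H by (simp add: l_eq mult_ac)
      also have "\<dots> = real H * sqrt (L / real n)"
        using L n by (simp add: real_div_sqrt real_sqrt_divide field_simps)
      finally show ?thesis .
    qed
    from this[of 1] this[of "-1"] show ?thesis unfolding real_n d_def by (simp add: abs_le_iff)
  qed
  show "Phat c x y u - pmf (P x y) u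
      \<le> pmf (P x y) u / (3 * real H) + 4 * real H * L / (real (v x y) + real k * real N)" for u
  proof -
    define l where "l = 1 / (2 * real H)"
    have mean: "(\<Sum>t\<in>UNIV. pmf (P x y) t * of_bool (t = u)) = pmf (P x y) u" by simp
    have dev: "(\<Sum>t\<in>UNIV. (Phat c x y t - pmf (P x y) t) * of_bool (t = u)) = Phat c x y u - pmf (P x y) u" by simp
    have "(x, y, \<lambda>t. l * (of_bool (t = u) - pmf (P x y) u) - 2 / 3 * l\<^sup>2 * pmf (P x y) u) \<in> Bernstein_weights P H"
      unfolding Bernstein_weights_def by (rule image_eqI[where x = "(x, y, u)"]) (auto simp: l_def)
    then have "log_weight (\<lambda>t. l * (of_bool (t = u) - pmf (P x y) u) - 2 / 3 * l\<^sup>2 * pmf (P x y) u) x y c \<le> 2 * L"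
      using weights by blast
    then have "real n * (l * (Phat c x y u - pmf (P x y) u) - 2 / 3 * l\<^sup>2 * pmf (P x y) u) \<le> 2 * L"
      using log_weight_affine[of c x y l "\<lambda>t. of_bool (t = u)" "P x y" "2 / 3 * l\<^sup>2 * pmf (P x y) u"] n sum
      by (simp only: mean dev) simp
    then have "l * (Phat c x y u - pmf (P x y) u) - 2 / 3 * l\<^sup>2 * pmf (P x y) u \<le> 2 * L / real n"
      using n by (simp add: pos_le_divide_eq mult.commute)
    then have "(2 * real H) * (l * (Phat c x y u - pmf (P x y) u) - 2 / 3 * l\<^sup>2 * pmf (P x y) u)
        \<le> (2 * real H) * (2 * L / real n)"
      by (intro mult_left_mono) auto
    moreover have "(2 * real H) * (l * (Phat c x y u - pmf (P x y) u) - 2 / 3 * l\<^sup>2 * pmf (P x y) u)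
        = Phat c x y u - pmf (P x y) u - pmf (P x y) u / (3 * real H)"
      using H by (simp add: l_def field_simps power2_eq_square)
    ultimately show ?thesis unfolding real_n by simp
  qed
qed (use r H L in auto)

section \<open>The regret bound\<close>

lemma sum_sqrt_le:
  assumes "\<And>i. i \<in> I \<Longrightarrow> 0 \<le> x i"
  shows "(\<Sum>i\<in>I. sqrt (x i)) \<le> sqrt (real (card I) * (\<Sum>i\<in>I. x i))"
proof (rule real_le_rsqrt)
  have "(\<Sum>i\<in>I. sqrt (x i))\<^sup>2 \<le> (\<Sum>i\<in>I. (sqrt (x i))\<^sup>2) * real (card I)"
    by (rule sum_squared_le_sum_of_squares)
  also have "(\<Sum>i\<in>I. (sqrt (x i))\<^sup>2) = (\<Sum>i\<in>I. x i)"
    using assms by (intro sum.cong) auto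
  finally show "(\<Sum>i\<in>I. sqrt (x i))\<^sup>2 \<le> real (card I) * (\<Sum>i\<in>I. x i)"
    by (simp add: mult.commute)
qed

text \<open>\<open>1 / a \<le> \<theta>\<close> turns the sampling rate into the damping factor. The
  coefficient 60 bounds \<open>133 / 60 * 8 * 2 * 1.42\<close>, where 1.42 exceeds
  \<open>sqrt 2\<close>.\<close>

lemma pair_potential_le:
  assumes H: "1 \<le> H" and K: "1 \<le> K" and v: "v \<le> K * H" and L: "2 \<le> L" "0 \<le> S"
    and log: "ln (real K * (real H + real N)) \<le> L - 1"
  defines "\<theta> \<equiv> (2 * real H - 1) / (real N + 2 * real H - 1)"
  shows "pair_potential H N L S K v - pair_potential H N L S 0 0
    \<le> 60 * sqrt \<theta> * real H * L * sqrt (real v) + 133 / 10 * \<theta> * S * real H ^ 2 * L ^ 2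
      + 19 / 5 * (real H ^ 2 / (real N + 1))"
proof -
  define a where "a = (real H + real N) / real H"
  have a: "1 \<le> a" using H by (simp add: a_def)
  have \<theta>: "0 \<le> \<theta>" using H by (simp add: \<theta>_def)
  have a\<theta>: "1 / a \<le> \<theta>"
  proof -
    have "real N \<le> real H * real N" using H by (simp add: mult_le_cancel_right1)
    then have "real H * (real N + 2 * real H - 1) \<le> (2 * real H - 1) * (real H + real N)"
      by (simp add: algebra_simps)
    then show ?thesis using H by (simp add: a_def \<theta>_def divide_simps)
  qed
  have "sqrt (2 / a) = sqrt 2 * sqrt (1 / a)" by (simp add: real_sqrt_divide)
  also have "\<dots> \<le> 142 / 100 * sqrt \<theta>"
    using a\<theta> a \<theta> by (intro mult_mono real_sqrt_le_mono real_le_lsqrt) (auto simp: power2_eq_square)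
  finally have "sqrt (2 / a) * (266 / 15 * 2 * real H * L * sqrt (real v))
      \<le> 142 / 100 * sqrt \<theta> * (266 / 15 * 2 * real H * L * sqrt (real v))"
    using L by (intro mult_right_mono) auto
  also have "\<dots> \<le> 60 * sqrt \<theta> * real H * L * sqrt (real v)"
  proof -
    have "142 / 100 * (266 / 15 * 2) * (sqrt \<theta> * real H * L * sqrt (real v)) \<le> 60 * (sqrt \<theta> * real H * L * sqrt (real v))"
      using L \<theta> by (intro mult_right_mono) auto
    then show ?thesis by (simp add: mult_ac)
  qed
  finally have 1: "sqrt (2 / a) * (266 / 15 * 2 * real H * L * sqrt (real v))
      \<le> 60 * sqrt \<theta> * real H * L * sqrt (real v)" .
  \<comment> \<open>The values of \<open>lnlin\<close> run from -2 to at most \<open>L - 1\<close>,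
    a range of \<open>L + 1\<close>, and \<open>L \<ge> 2\<close>.\<close>
  have "lnlin (real v * a / real H - 1) - lnlin (- 1) \<le> 3 / 2 * L"
  proof -
    have "real v \<le> real K * real H" using v by (metis of_nat_le_iff of_nat_mult)
    then have "real v * a / real H \<le> real K * real H * a / real H"
      using H a by (intro divide_right_mono mult_right_mono) auto
    also have "\<dots> = real K * a" using H by simp
    finally have "lnlin (real v * a / real H - 1) \<le> lnlin (real K * a - 1)"
      by (intro lnlin_mono diff_right_mono)
    also have "\<dots> \<le> ln (real K * a)"
      using K a mult_mono[of 1 "real K" 1 a] by (intro lnlin_le_ln) auto
    also have "\<dots> \<le> ln (real K * (real H + real N))"
    proof -
      have "a \<le> real H + real N" using H by (simp add: a_def divide_simps mult_le_cancel_left1)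
      then show ?thesis using K a by (subst ln_le_cancel_iff) auto
    qed
    finally show ?thesis using log L by (simp add: lnlin_def)
  qed
  then have "133 / 15 * real H ^ 2 * S * L * ((1 / a) * (lnlin (real v * a / real H - 1) - lnlin (- 1)))
      \<le> 133 / 15 * real H ^ 2 * S * L * (\<theta> * (3 / 2 * L))"
  proof (intro mult_left_mono)
    assume *: "lnlin (real v * a / real H - 1) - lnlin (- 1) \<le> 3 / 2 * L"
    have "lnlin (- 1) \<le> lnlin (real v * a / real H - 1)"
      using a by (intro lnlin_mono) simp
    then show "(1 / a) * (lnlin (real v * a / real H - 1) - lnlin (- 1)) \<le> \<theta> * (3 / 2 * L)"
      using * a\<theta> a \<theta> by (intro mult_mono) auto
  qed (use L in auto)
  also have "\<dots> = 133 / 10 * \<theta> * S * real H ^ 2 * L ^ 2"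
    by (simp add: power2_eq_square)
  finally have 2: "133 / 15 * real H ^ 2 * S * L * ((1 / a) * (lnlin (real v * a / real H - 1) - lnlin (- 1)))
      \<le> 133 / 10 * \<theta> * S * real H ^ 2 * L ^ 2" .
  have "19 / 5 * real H * (min (real H) (real K * real N + real v) / (real N + 1)) \<le> 19 / 5 * real H * (real H / (real N + 1))"
    by (intro mult_left_mono divide_right_mono) auto
  also have "\<dots> = 19 / 5 * (real H ^ 2 / (real N + 1))"
    by (simp add: power2_eq_square)
  finally have 3: "19 / 5 * real H * (min (real H) (real K * real N + real v) / (real N + 1))
      \<le> 19 / 5 * (real H ^ 2 / (real N + 1))" .
  have 4: "pair_potential H N L S K v - pair_potential H N L S 0 0
      = sqrt (2 / a) * (266 / 15 * 2 * real H * L * sqrt (real v))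
      + 133 / 15 * real H ^ 2 * S * L * ((1 / a) * (lnlin (real v * a / real H - 1) - lnlin (- 1)))
      + 19 / 5 * real H * (min (real H) (real K * real N + real v) / (real N + 1))"
    by (simp add: pair_potential_def Let_def a_def[symmetric] algebra_simps diff_divide_distrib)
  show ?thesis
    unfolding 4 by (rule add_mono[OF add_mono[OF 1 2] 3])
qed

text \<open>The summand with \<open>sqrt (real K * L / 2)\<close> is the price of fluctuations over
  \<open>K\<close> episodes of range \<open>19 / 5 * real H\<close> at failure probability
  \<open>exp (- L)\<close>.\<close>

lemma potential_le:
  fixes v :: "('s::finite,'a::finite) vcounts"
  defines "S \<equiv> real CARD('s)" and "A \<equiv> real CARD('a)"
  assumes H: "1 \<le> H" and K: "1 \<le> K" and L: "2 \<le> L"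
    and v: "(\<Sum>x\<in>UNIV. \<Sum>y\<in>UNIV. real (v x y)) = real K * real H"
    and log: "ln (real K * (real H + real N)) \<le> L - 1"
  shows "potential H N L K v - potential H N L 0 ((\<lambda>_ _. 0) :: ('s,'a) vcounts) + 19 / 5 * real H * sqrt (real K * L / 2)
      \<le> S * A * real H ^ 2 / (real N + 1)
       + exp 1 * (real H + 1) * sqrt (real K * L)
       + 60 * sqrt ((2 * real H - 1) / (real N + 2 * real H - 1)) * real H powr (3/2) * L * sqrt (S * A * real K)
       + 15 * ((2 * real H - 1) / (real N + 2 * real H - 1)) * S ^ 2 * A * real H ^ 2 * L ^ 2"
proof -
  define \<theta> where "\<theta> = (2 * real H - 1) / (real N + 2 * real H - 1)"
  have SA: "1 \<le> S" "1 \<le> A" by (auto simp: S_def A_def Suc_le_eq)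
  have \<theta>: "0 \<le> \<theta>" using H by (simp add: \<theta>_def)
  have vle: "v x y \<le> K * H" for x y
  proof -
    have "real (v x y) \<le> (\<Sum>x\<in>UNIV. \<Sum>y\<in>UNIV. real (v x y))"
      by (rule member_le_double_sum) simp
    then show ?thesis unfolding v by (metis of_nat_le_iff of_nat_mult)
  qed
  have "potential H N L K v - potential H N L 0 ((\<lambda>_ _. 0) :: ('s,'a) vcounts)
      = (\<Sum>x\<in>UNIV. \<Sum>y\<in>UNIV. pair_potential H N L S K (v x y) - pair_potential H N L S 0 0)"
    by (simp add: potential_def S_def sum_subtractf)
  also have "\<dots> \<le> (\<Sum>x\<in>(UNIV::'s set). \<Sum>y\<in>(UNIV::'a set). 60 * sqrt \<theta> * real H * L * sqrt (real (v x y))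
      + 133 / 10 * \<theta> * S * real H ^ 2 * L ^ 2 + 19 / 5 * (real H ^ 2 / (real N + 1)))"
    unfolding \<theta>_def using SA by (intro sum_mono pair_potential_le H K vle L log) auto
  also have "\<dots> = 60 * sqrt \<theta> * real H * L * (\<Sum>x\<in>(UNIV::'s set). \<Sum>y\<in>(UNIV::'a set). sqrt (real (v x y)))
      + 133 / 10 * \<theta> * S ^ 2 * A * real H ^ 2 * L ^ 2 + 19 / 5 * (S * A * real H ^ 2 / (real N + 1))"
    by (simp add: sum.distrib sum_distrib_left S_def A_def power2_eq_square mult_ac)
  \<comment> \<open>Cauchy-Schwarz over all pairs, whose visits total \<open>K * H\<close>.\<close>
  also have "60 * sqrt \<theta> * real H * L * (\<Sum>x\<in>(UNIV::'s set). \<Sum>y\<in>(UNIV::'a set). sqrt (real (v x y)))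
      \<le> 60 * sqrt \<theta> * real H * L * (sqrt (real H) * sqrt (S * A * real K))"
  proof (rule mult_left_mono)
    have "(\<Sum>x\<in>(UNIV::'s set). \<Sum>y\<in>(UNIV::'a set). sqrt (real (v x y)))
        = (\<Sum>z\<in>(UNIV::('s \<times> 'a) set). sqrt (real (v (fst z) (snd z))))"
      by (simp add: sum.cartesian_product case_prod_unfold)
    also have "\<dots> \<le> sqrt (real (card (UNIV::('s \<times> 'a) set)) * (\<Sum>z\<in>(UNIV::('s \<times> 'a) set). real (v (fst z) (snd z))))"
      by (rule sum_sqrt_le) auto
    also have "(\<Sum>z\<in>(UNIV::('s \<times> 'a) set). real (v (fst z) (snd z))) = real K * real H"
      unfolding v[symmetric] by (simp add: sum.cartesian_product case_prod_unfold)
    also have "sqrt (real (card (UNIV::('s \<times> 'a) set)) * (real K * real H)) = sqrt (real H) * sqrt (S * A * real K)"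
      by (simp add: S_def A_def real_sqrt_mult mult_ac)
    finally show "(\<Sum>x\<in>(UNIV::'s set). \<Sum>y\<in>(UNIV::'a set). sqrt (real (v x y))) \<le> sqrt (real H) * sqrt (S * A * real K)" .
  qed (use L \<theta> in auto)
  also have "60 * sqrt \<theta> * real H * L * (sqrt (real H) * sqrt (S * A * real K))
      = 60 * sqrt \<theta> * real H powr (3/2) * L * sqrt (S * A * real K)"
  proof -
    have "real H powr (3/2) = real H * sqrt (real H)"
      using H powr_add[of "real H" 1 "1/2"] by (simp add: powr_half_sqrt)
    then show ?thesis by simp
  qed
  finally have 1: "potential H N L K v - potential H N L 0 ((\<lambda>_ _. 0) :: ('s,'a) vcounts)
      \<le> 60 * sqrt \<theta> * real H powr (3/2) * L * sqrt (S * A * real K)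
      + 133 / 10 * \<theta> * S ^ 2 * A * real H ^ 2 * L ^ 2 + 19 / 5 * (S * A * real H ^ 2 / (real N + 1))"
    by simp
  \<comment> \<open>The charge for pairs with few samples exceeds the first term of the bound by
    \<open>19 / 5 - 1 = 14 / 5\<close> times that term. The excess fits into the slack
    \<open>15 - 133 / 10 = 17 / 10\<close> of the last term, as
    \<open>1 / (N + 1) \<le> \<theta>\<close> and \<open>4 \<le> L\<^sup>2 * S\<close>.\<close>
  have 2: "14 / 5 * (S * A * real H ^ 2 / (real N + 1)) \<le> 17 / 10 * \<theta> * S ^ 2 * A * real H ^ 2 * L ^ 2"
  proof -
    have "1 / (real N + 1) \<le> \<theta>"
    proof -
      have "real N \<le> real H * real N" using H by (simp add: mult_le_cancel_right1)
      then have "real N + 2 * real H - 1 \<le> (2 * real H - 1) * (real N + 1)"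
        by (simp add: algebra_simps)
      then show ?thesis using H by (simp add: \<theta>_def divide_simps)
    qed
    then have "14 / 5 * (S * A * real H ^ 2 * (1 / (real N + 1))) \<le> 14 / 5 * (S * A * real H ^ 2 * \<theta>)"
      using SA by (intro mult_left_mono) auto
    also have "\<dots> \<le> (17 / 10 * L ^ 2 * S) * (S * A * real H ^ 2 * \<theta>)"
    proof (rule mult_right_mono)
      have "4 * 1 \<le> L ^ 2 * S"
        using L SA power_mono[of 2 L 2] by (intro mult_mono) auto
      then show "14 / 5 \<le> 17 / 10 * L ^ 2 * S" by simp
    qed (use SA \<theta> in auto)
    finally show ?thesis by (simp add: power2_eq_square mult_ac)
  qed
  \<comment> \<open>\<open>19 / 5 / sqrt 2\<close> is about 2.69, below
    \<open>exp 1\<close>.\<close>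
  have 3: "19 / 5 * real H * sqrt (real K * L / 2) \<le> exp 1 * (real H + 1) * sqrt (real K * L)"
  proof -
    have "sqrt (1 / 2) \<le> 708 / (1000 :: real)"
      by (intro real_le_lsqrt) (auto simp: power2_eq_square)
    then have "19 / 5 * sqrt (1 / 2) \<le> (exp 1 :: real)"
      using e_approx_32 by (simp add: abs_if split: if_splits)
    then have "real H * (19 / 5 * sqrt (1 / 2)) \<le> (real H + 1) * exp 1"
      by (intro mult_mono) auto
    then have "real H * (19 / 5 * sqrt (1 / 2)) * sqrt (real K * L) \<le> (real H + 1) * exp 1 * sqrt (real K * L)"
      using L by (intro mult_right_mono) auto
    moreover have "sqrt (real K * L / 2) = sqrt (1 / 2) * sqrt (real K * L)"
      by (simp add: real_sqrt_divide)
    ultimately show ?thesis by (simp add: mult_ac)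
  qed
  define w where "w = \<theta> * S ^ 2 * A * real H ^ 2 * L ^ 2"
  have w: "c * \<theta> * S ^ 2 * A * real H ^ 2 * L ^ 2 = c * w" for c
    by (simp add: w_def mult_ac)
  have "d + e \<le> x + g + m + 15 * w"
    if "d \<le> m + 133 / 10 * w + 19 / 5 * x" "14 / 5 * x \<le> 17 / 10 * w" "e \<le> g" for d e x g m w :: real
    using that by linarith
  from this[OF 1[unfolded w] 2[unfolded w] 3] show ?thesis
    unfolding \<theta>_def[symmetric] w .
qed

text \<open>Over \<open>K\<close> planning times, the first summand counts Bernstein weights and the
  second Hoeffding weights for both tails. A quadratic bound suffices, since the failure exponent is
  \<open>2 * L\<close>.\<close>

lemma failure_count:
  fixes S A H K N :: nat
  assumes "1 \<le> S" "1 \<le> A" "1 \<le> H" "1 \<le> K"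
  shows "K * (S * A * S + S * A * H * (K * (H + N)) * 2) \<le> 3 * (S * A * K * (H + N)) ^ 2"
proof -
  have "K * (S * A * S) * 1 \<le> K * (S * A * S) * (A * K * ((H + N) * (H + N)))"
    using assms by (intro mult_le_mono2) (simp add: Suc_le_eq)
  moreover have "(S * A * K * K * (H + N)) * H \<le> (S * A * K * K * (H + N)) * (S * A * (H + N))"
  proof (rule mult_le_mono2)
    have "1 * H \<le> (S * A) * (H + N)" using assms by (intro mult_le_mono) (auto simp: Suc_le_eq)
    then show "H \<le> S * A * (H + N)" by simp
  qed
  ultimately show ?thesis by (simp add: power2_eq_square algebra_simps)
qed

theorem theorem3:
  fixes P :: "'s::finite \<Rightarrow> 'a::finite \<Rightarrow> 's pmf"
    and r :: "'s \<Rightarrow> 'a \<Rightarrow> real"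
    and H K N :: nat and p :: real and init :: "nat \<Rightarrow> 's"
  defines "S \<equiv> real CARD('s)" and "A \<equiv> real CARD('a)"
    and "L \<equiv> LN TYPE('s) TYPE('a) H N K p"
  assumes "0 < p" and "p < 1"
    and "\<forall>s a. 0 \<le> r s a \<and> r s a \<le> 1"
    and "N \<ge> 1"
    and "L > 1"
  shows "measure_pmf.prob (ucbvi_run P r H N L init K)
     {(c, v, pols). regret P r H init pols \<le>
         S * A * real H ^ 2 / (real N + 1)
       + exp 1 * (real H + 1) * sqrt (real K * L)
       + 60 * sqrt ((2 * real H - 1) / (real N + 2 * real H - 1)) * real H powr (3/2) * L * sqrt (S * A * real K)
       + 15 * ((2 * real H - 1) / (real N + 2 * real H - 1)) * S ^ 2 * A * real H ^ 2 * L ^ 2}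
     \<ge> 1 - p"
    (is "measure_pmf.prob ?run {(c, v, pols). _ \<le> ?B} \<ge> _")
proof (cases "H = 0")
  case True
  \<comment> \<open>Without steps all values and the regret vanish, and the bound reduces to
    \<open>exp 1 * sqrt (real K * L)\<close>.\<close>
  then have everything: "{(c, v, pols). regret P r H init pols \<le> ?B} = UNIV"
    using \<open>L > 1\<close> by (auto simp: regret_def)
  show ?thesis
    unfolding everything using \<open>0 < p\<close> measure_pmf.prob_space[of ?run] by simp
next
  case False
  then have H: "1 \<le> H" by simp
  have K: "1 \<le> K"
  proof (rule ccontr)
    assume "\<not> 1 \<le> K"
    then have "K = 0" by simp
    \<comment> \<open>In HOL \<open>ln 0 = 0\<close>, which contradicts
      \<open>L > 1\<close>.\<close>
    then show False using \<open>L > 1\<close> by (simp add: L_def LN_def)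
  qed
  have r: "0 \<le> r s a" "r s a \<le> 1" for s a using assms(6) by auto

  \<comment> \<open>Numerical consequences of the parameter ranges\<close>
  have S: "1 \<le> S" and A: "1 \<le> A" by (auto simp: S_def A_def Suc_le_eq)
  define q where "q = S * A * real K * (real H + real N)"
  have SA: "1 \<le> S * A" using S A mult_mono[of 1 S 1 A] by simp
  have KHN: "2 \<le> real K * (real H + real N)"
    using K H \<open>N \<ge> 1\<close> mult_mono[of 1 "real K" 2 "real H + real N"] by simp
  have q_ge: "real K * (real H + real N) \<le> q"
    using SA KHN mult_right_mono[of 1 "S * A" "real K * (real H + real N)"] by (simp add: q_def mult_ac)
  have L_eq: "L = ln (5 * q / p)" by (simp add: L_def LN_def q_def S_def A_def mult_ac)
  have exp_L: "exp L = 5 * q / p" unfolding L_eq using q_ge KHN \<open>0 < p\<close> by simp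
  have qp: "q \<le> q / p" using q_ge KHN \<open>0 < p\<close> \<open>p < 1\<close> by (simp add: pos_le_divide_eq mult_le_cancel_left1)
  \<comment> \<open>\<open>exp L = 5 * q / p\<close> is at least 10, which exceeds
    \<open>2.72 * 2.72\<close>, an upper bound of \<open>exp 2\<close>.\<close>
  have L2: "2 \<le> L"
  proof -
    have "exp 2 = exp 1 * (exp 1 :: real)" by (simp add: exp_add[symmetric])
    also have "\<dots> \<le> 272 / 100 * (272 / 100)"
      using e_less_272 by (intro mult_mono) auto
    also have "\<dots> \<le> exp L" unfolding exp_L using qp q_ge KHN by simp
    finally show ?thesis by simp
  qed
  have log: "ln (real K * (real H + real N)) \<le> L - 1"
  proof -
    have "exp 1 * (real K * (real H + real N)) \<le> 5 * (q / p)"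
      using q_ge qp KHN e_less_272 by (intro mult_mono) auto
    then have "ln (exp 1 * (real K * (real H + real N))) \<le> L"
      unfolding L_eq using KHN q_ge \<open>0 < p\<close> by (subst ln_le_cancel_iff) auto
    moreover have "ln (exp 1 * (real K * (real H + real N))) = 1 + ln (real K * (real H + real N))"
      using KHN by (subst ln_mult_pos) auto
    ultimately show ?thesis by simp
  qed

  \<comment> \<open>Failure events and their probabilities\<close>
  define \<Xi> where "\<Xi> = Bernstein_weights P H \<union> Hoeffding_weights P r H L (K * (H + N))"
  define G where "G c \<longleftrightarrow> (\<forall>x y \<xi>. (x, y, \<xi>) \<in> \<Xi> \<longrightarrow> log_weight \<xi> x y c \<le> 2 * L)" for c :: "('s,'a) tcounts"
  define F where "F = flagged_run G P r H N L init K"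
  define \<Psi> :: "nat \<Rightarrow> ('s,'a) vcounts \<Rightarrow> real" where "\<Psi> = potential H N L"
  define R where "R = 19 / 5 * real H"
  \<comment> \<open>Optimal Chernoff exponent: a deviation \<open>R * sqrt (real K * L / 2)\<close>
    gains \<open>2 * L\<close>, while the compensators of \<open>K\<close> episodes cost
    \<open>L\<close>.\<close>
  define l where "l = sqrt (8 * L / real K) / R"
  have R: "0 < R" using H by (simp add: R_def)
  have l: "0 < l" using R K L2 by (simp add: l_def)

  \<comment> \<open>At most \<open>3 * q\<^sup>2\<close> events, each of probability at most
    \<open>exp (- (2 * L)) = (p / (5 * q))\<^sup>2\<close>, total at most
    \<open>3 / 25 * p\<^sup>2\<close>.\<close>
  have lost: "(\<integral>\<^sup>+z. of_bool (\<not> snd z) \<partial>F) \<le> ennreal (p / 2)"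
  proof -
    have "(\<integral>\<^sup>+z. of_bool (\<not> snd z) \<partial>F) \<le> ennreal (real K * real (card \<Xi>) * exp (- (2 * L)))"
      unfolding F_def
    proof (rule flag_lost_le)
      fix x y \<xi> assume "(x, y, \<xi>) \<in> \<Xi>"
      then show "(\<integral>\<^sup>+t. ennreal (exp (\<xi> t)) \<partial>P x y) \<le> 1"
        unfolding \<Xi>_def using Bernstein_weights_le[of x y \<xi> P H] Hoeffding_weights_le[of x y \<xi> P r H L]
          H L2 r by auto
    qed (auto simp: G_def \<Xi>_def finite_weights)
    also have "\<dots> \<le> ennreal (p / 2)"
    proof (rule ennreal_leI)
      have "real (K * card \<Xi>) \<le> 3 * q\<^sup>2"
      proof -
        have "K * card \<Xi> \<le> K * (CARD('s) * CARD('a) * CARD('s) + CARD('s) * CARD('a) * H * (K * (H + N)) * 2)"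
          unfolding \<Xi>_def by (intro mult_le_mono2 card_weights)
        also have "\<dots> \<le> 3 * (CARD('s) * CARD('a) * K * (H + N)) ^ 2"
          using H K by (intro failure_count) (auto simp: Suc_le_eq)
        finally have "real (K * card \<Xi>) \<le> real (3 * (CARD('s) * CARD('a) * K * (H + N)) ^ 2)"
          by (simp only: of_nat_le_iff)
        then show ?thesis by (simp add: q_def S_def A_def)
      qed
      moreover have "exp (- (2 * L)) = 1 / (5 * q / p)\<^sup>2"
        by (simp add: exp_minus exp_double exp_L inverse_eq_divide)
      ultimately have "real K * real (card \<Xi>) * exp (- (2 * L)) \<le> 3 * q\<^sup>2 * (1 / (5 * q / p)\<^sup>2)"
        by (simp only: of_nat_mult) (intro mult_right_mono; simp)
      also have "\<dots> = 3 / 25 * p * p"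
        using q_ge KHN \<open>0 < p\<close> by (simp add: power2_eq_square field_simps)
      also have "\<dots> \<le> 3 / 25 * p * 1"
        using \<open>0 < p\<close> \<open>p < 1\<close> by (intro mult_left_mono) auto
      finally show "real K * real (card \<Xi>) * exp (- (2 * L)) \<le> p / 2" using \<open>0 < p\<close> by simp
    qed
    finally show ?thesis .
  qed

  define W where "W z = ennreal (of_bool (snd z)
      * exp (l * (regret P r H init (snd (snd (fst z))) - \<Psi> K (fst (snd (fst z)))) - real K * (l\<^sup>2 * R\<^sup>2 / 8)))"
    for z :: "(('s,'a) tcounts \<times> ('s,'a) vcounts \<times> ('s,'a) policy list) \<times> bool"
  have martingale: "(\<integral>\<^sup>+z. W z \<partial>F) \<le> ennreal (exp (- l * \<Psi> 0 (\<lambda>_ _. 0)))"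
    unfolding F_def W_def
  proof (rule exp_regret_supermartingale[OF l _ order_refl])
    fix k c v pols c' pol
    assume k: "k < K" and run: "(c, v, pols) \<in> set_pmf (ucbvi_run P r H N L init k)"
      and c': "c' \<in> set_pmf (ext_samples P N c)" and "G c'"
      and pol: "pol = ucb_policy r H N L (Suc k) c' v"
    have v: "v x y \<le> k * H" for x y
    proof -
      have "real (v x y) \<le> (\<Sum>x\<in>UNIV. \<Sum>y\<in>UNIV. real (v x y))"
        by (rule member_le_double_sum) simp
      then show ?thesis unfolding ucbvi_run_support(2)[OF run] by (metis of_nat_le_iff of_nat_mult)
    qed
    have "accurate_model P r H N L (Suc k) c' v (\<lambda>x y. real (v x y) + real (Suc k) * real N)"
    proof (rule accurate_modelI)
      show "log_weight \<xi> x y c' \<le> 2 * L"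
        if "(x, y, \<xi>) \<in> Bernstein_weights P H \<union> Hoeffding_weights P r H L (K * (H + N))" for x y \<xi>
        using \<open>G c'\<close> that by (auto simp: G_def \<Xi>_def)
      show "(\<Sum>t\<in>UNIV. c' x y t) = v x y + Suc k * N" for x y
        using ext_samples_support[OF c', of x y] ucbvi_run_support(3)[OF run, of x y] by simp
      \<comment> \<open>At planning time there are at most \<open>K * H\<close> own and
        \<open>K * N\<close> external samples, so the tabulated counts suffice.\<close>
      show "v x y + Suc k * N \<in> {1..K * (H + N)}" for x y
      proof -
        have "v x y \<le> K * H" using v[of x y] k by (meson le_trans less_imp_le mult_le_mono1)
        moreover have "Suc k * N \<le> K * N" using k by (intro mult_le_mono1) simp
        ultimately show ?thesis using \<open>N \<ge> 1\<close> by (simp add: distrib_left)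
      qed
    qed (use r H L2 in auto)
    then interpret accurate_model P r H N L "Suc k" c' v "\<lambda>x y. real (v x y) + real (Suc k) * real N" .
    show "\<exists>X. (\<forall>z. 0 \<le> X z \<and> X z \<le> R) \<and>
        Vstar_togo P r H (init (Suc k)) - Vpi_togo P r H pol H (init (Suc k))
          \<le> measure_pmf.expectation (play P pol H H (init (Suc k)) (c', v)) X \<and>
        (\<forall>z\<in>set_pmf (play P pol H H (init (Suc k)) (c', v)). X z \<le> \<Psi> (Suc k) (snd z) - \<Psi> k v)"
      using episode_regret[OF refl v] unfolding R_def \<Psi>_def pol pol_def .
  qed

  \<comment> \<open>On this event the exponent of \<open>W\<close>, corrected by the initial
    potential, is at least \<open>2 * L - L = L\<close>.\<close>
  have tail: "of_bool (snd z \<and> ?B < regret P r H init (snd (snd (fst z))))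
      \<le> W z * ennreal (exp (l * \<Psi> 0 (\<lambda>_ _. 0) - L))" if "z \<in> set_pmf F" for z
  proof (cases "snd z \<and> ?B < regret P r H init (snd (snd (fst z)))")
    case True
    have "fst z \<in> set_pmf (map_pmf fst F)" using that by simp
    then have "(fst (fst z), fst (snd (fst z)), snd (snd (fst z))) \<in> set_pmf (ucbvi_run P r H N L init K)"
      by (simp only: F_def map_fst_flagged_run prod.collapse)
    from potential_le[OF H K L2 ucbvi_run_support(2)[OF this] log] True
    have "\<Psi> K (fst (snd (fst z))) - \<Psi> 0 (\<lambda>_ _. 0) + R * sqrt (real K * L / 2) \<le> regret P r H init (snd (snd (fst z)))"
      unfolding \<Psi>_def R_def S_def A_def by linarith
    then have "l * (R * sqrt (real K * L / 2)) \<le> l * (regret P r H init (snd (snd (fst z))) - \<Psi> K (fst (snd (fst z))) + \<Psi> 0 (\<lambda>_ _. 0))"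
      using l by (intro mult_left_mono) auto
    moreover have "l * (R * sqrt (real K * L / 2)) = 2 * L"
    proof -
      have "l * (R * sqrt (real K * L / 2)) = sqrt (8 * L / real K) * sqrt (real K * L / 2)"
        using R by (simp add: l_def)
      also have "\<dots> = sqrt ((2 * L)\<^sup>2)"
        unfolding real_sqrt_mult[symmetric] using K by (simp add: power2_eq_square)
      also have "\<dots> = 2 * L" using L2 by (subst real_sqrt_abs) simp
      finally show ?thesis .
    qed
    moreover have "real K * (l\<^sup>2 * R\<^sup>2 / 8) = L"
      using R K L2 by (simp add: l_def power_divide)
    ultimately have "0 \<le> l * (regret P r H init (snd (snd (fst z))) - \<Psi> K (fst (snd (fst z)))) - real K * (l\<^sup>2 * R\<^sup>2 / 8)
        + (l * \<Psi> 0 (\<lambda>_ _. 0) - L)"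
      by (simp add: algebra_simps)
    then have "1 \<le> exp (l * (regret P r H init (snd (snd (fst z))) - \<Psi> K (fst (snd (fst z)))) - real K * (l\<^sup>2 * R\<^sup>2 / 8)
        + (l * \<Psi> 0 (\<lambda>_ _. 0) - L))"
      by simp
    then have "ennreal 1 \<le> W z * ennreal (exp (l * \<Psi> 0 (\<lambda>_ _. 0) - L))"
      unfolding W_def using True by (subst ennreal_mult[symmetric]) (auto simp flip: exp_add intro!: ennreal_leI)
    then show ?thesis using True by simp
  qed auto
  have large: "(\<integral>\<^sup>+z. of_bool (snd z \<and> ?B < regret P r H init (snd (snd (fst z)))) \<partial>F) \<le> ennreal (p / 2)"
  proof -
    have "(\<integral>\<^sup>+z. of_bool (snd z \<and> ?B < regret P r H init (snd (snd (fst z)))) \<partial>F)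
        \<le> (\<integral>\<^sup>+z. W z * ennreal (exp (l * \<Psi> 0 (\<lambda>_ _. 0) - L)) \<partial>F)"
      by (intro nn_integral_mono_AE AE_pmfI tail)
    also have "\<dots> \<le> ennreal (exp (- l * \<Psi> 0 (\<lambda>_ _. 0))) * ennreal (exp (l * \<Psi> 0 (\<lambda>_ _. 0) - L))"
      using martingale by (subst nn_integral_multc) (auto intro: mult_right_mono)
    also have "\<dots> = ennreal (exp (- L))"
      by (simp add: ennreal_mult[symmetric] exp_add[symmetric])
    also have "\<dots> \<le> ennreal (p / 2)"
    proof (rule ennreal_leI)
      have "p * 2 \<le> p * (5 * q)" using q_ge KHN \<open>0 < p\<close> by (intro mult_left_mono) auto
      then show "exp (- L) \<le> p / 2"
        using q_ge KHN \<open>0 < p\<close> by (simp add: exp_minus exp_L field_simps)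
    qed
    finally show ?thesis .
  qed

  \<comment> \<open>Combination of the two failure events\<close>
  define Good where "Good = {(c :: ('s,'a) tcounts, v :: ('s,'a) vcounts, pols). regret P r H init pols \<le> ?B}"
  have "emeasure (measure_pmf ?run) (- Good) = (\<integral>\<^sup>+z. indicator (- Good) (fst z) \<partial>F)"
    unfolding F_def by (subst nn_integral_flagged_run) simp
  also have "\<dots> \<le> (\<integral>\<^sup>+z. of_bool (\<not> snd z) + of_bool (snd z \<and> ?B < regret P r H init (snd (snd (fst z)))) \<partial>F)"
    by (intro nn_integral_mono) (auto simp: Good_def indicator_def)
  also have "\<dots> = (\<integral>\<^sup>+z. of_bool (\<not> snd z) \<partial>F)
      + (\<integral>\<^sup>+z. of_bool (snd z \<and> ?B < regret P r H init (snd (snd (fst z)))) \<partial>F)"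
    by (intro nn_integral_add) auto
  also have "\<dots> \<le> ennreal (p / 2) + ennreal (p / 2)"
    by (intro add_mono lost large)
  also have "\<dots> = ennreal p"
    using \<open>0 < p\<close> by (simp add: ennreal_plus[symmetric] del: ennreal_plus)
  finally have "measure_pmf.prob ?run (- Good) \<le> p"
    using \<open>0 < p\<close> by (simp add: measure_pmf.emeasure_eq_measure)
  moreover have "measure_pmf.prob ?run (- Good) = 1 - measure_pmf.prob ?run Good"
    using measure_pmf.prob_compl[of Good ?run] by (simp add: Compl_eq_Diff_UNIV)
  ultimately show ?thesis by (simp add: Good_def)
qed

end
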